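(* Identify colorings $x : T \to \{0,1\}$ with points of the Cantor space $\{0,1\}^{\mathbb{N}}$ via a fixed computable enumeration of $T$. The set $\mathcal{W}\subseteq\{0,1\}^T$ of colorings that are winning for black is $\mathbf{\Sigma}^0_4$-hard with respect to Wadge reductions in the boldface hierarchy, and $\Sigma^0_4$-hard with respect to Turing reductions in the lightface hierarchy. That is, for every (boldface) $\mathbf{\Sigma}^0_4$ set $A\subseteq\{0,1\}^{\mathbb{N}}$ there is a continuous $f$ with $f^{-1}(\mathcal{W})=A$, and for every lightface $\Sigma^0_4$ set $A$ there is a computable such $f$.
   Context: Fix a regular hexagonal tiling of $\mathbb{R}^2$ in which some tile edges are horizontal, and let $T$ be its set of tiles. Two tiles are adjacent if they share an edge. A coloring is a map $x : T \to \{0,1\}$; tiles with $x(t)=1$ are black. A path is a sequence of tiles $(t_i)_{i\in I}$, $I\subseteq\mathbb{Z}$ an interval, with consecutive tiles adjacent; it is black if all its tiles are black. Fix tiles $(d_n)_{n\in\mathbb{Z}}$ with each $d_n$ the northeast neighbour of $d_{n-1}$. $Q^+_n$ is the set of tiles obtained from $d_n$ by translations by vectors in $[0,\infty)^2$, and $Q^-_n$ the set of tiles obtained from $d_n$ by translations by vectors in $(-\infty,0]^2$. For $*\in\{+,-\}$, a one-way infinite path $(t_i)_{i\in\mathbb{N}}$ reaches to $*$ if for every $n$ there is $i$ with $t_j\in Q^*_n$ for all $j\ge i$. A coloring is winning for black if there are black paths $(t_i)_{i\in\mathbb{N}}$, $(s_i)_{i\in\mathbb{N}}$ with $t_0=s_0$,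 $(t_i)$ reaching to $+$ and $(s_i)$ reaching to $-$. A Wadge reduction of $A$ to $B$ is a continuous $f$ with $f^{-1}(B)=A$; a Turing reduction is a computable one (computed by an oracle Turing machine). *)

theory Defs
  imports "HOL-Analysis.Analysis" "HOL-Library.Nat_Bijection"
begin

section \<open>The hexagonal tiling\<close>

type_synonym tile = "(real \<times> real) set"

text \<open>The regular hexagon with centre \<open>c\<close> and side length \<open>r\<close>. Its vertices have the directions
  \<open>k * pi / 3\<close>, so two of its edges are horizontal.\<close>

definition hexagon :: "real \<Rightarrow> real \<times> real \<Rightarrow> tile" where
  "hexagon r c =
     convex hull ((\<lambda>k. c + (r * cos (real k * pi / 3), r * sin (real k * pi / 3))) ` {..<6})"

text \<open>The centres form the lattice spanned by the steps to the northeast neighbour,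
  \<open>(3/2 * r, sqrt 3 / 2 * r)\<close>, and to the north neighbour, \<open>(0, sqrt 3 * r)\<close>.\<close>

definition hex_tile :: "real \<Rightarrow> real \<times> real \<Rightarrow> int \<times> int \<Rightarrow> tile" where
  "hex_tile r p = (\<lambda>(a, b). hexagon r
     (p + of_int a *\<^sub>R (3 / 2 * r, sqrt 3 / 2 * r) + of_int b *\<^sub>R (0, sqrt 3 * r)))"

definition hex_tiling :: "real \<Rightarrow> real \<times> real \<Rightarrow> tile set" where
  "hex_tiling r p = range (hex_tile r p)"

definition adjacent :: "tile \<Rightarrow> tile \<Rightarrow> bool" where
  "adjacent s t \<longleftrightarrow> s \<noteq> t \<and> (\<exists>F. F edge_of s \<and> F edge_of t)"

definition northeast_neighbour :: "tile \<Rightarrow> tile \<Rightarrow> bool" where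
  "northeast_neighbour s t \<longleftrightarrow> adjacent s t \<and> (\<exists>u > 0. \<exists>v > 0. t = (+) (u, v) ` s)"

section \<open>Winning colorings\<close>

text \<open>A coloring is a function on tiles whose value is \<open>True\<close> at the black tiles; only its values
  on the tiling \<open>T\<close> are ever used.\<close>

definition black_path :: "tile set \<Rightarrow> (tile \<Rightarrow> bool) \<Rightarrow> (nat \<Rightarrow> tile) \<Rightarrow> bool" where
  "black_path T x t \<longleftrightarrow> (\<forall>i. t i \<in> T \<and> x (t i) \<and> adjacent (t i) (t (Suc i)))"

definition Q_plus :: "tile set \<Rightarrow> (int \<Rightarrow> tile) \<Rightarrow> int \<Rightarrow> tile set" where
  "Q_plus T d n = {t \<in> T. \<exists>u \<ge> 0. \<exists>v \<ge> 0. t = (+) (u, v) ` d n}"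

definition Q_minus :: "tile set \<Rightarrow> (int \<Rightarrow> tile) \<Rightarrow> int \<Rightarrow> tile set" where
  "Q_minus T d n = {t \<in> T. \<exists>u \<le> 0. \<exists>v \<le> 0. t = (+) (u, v) ` d n}"

definition reaches :: "(int \<Rightarrow> tile set) \<Rightarrow> (nat \<Rightarrow> tile) \<Rightarrow> bool" where
  "reaches Q t \<longleftrightarrow> (\<forall>n. \<exists>i. \<forall>j \<ge> i. t j \<in> Q n)"

definition winning_for_black :: "tile set \<Rightarrow> (int \<Rightarrow> tile) \<Rightarrow> (tile \<Rightarrow> bool) \<Rightarrow> bool" where
  "winning_for_black T d x \<longleftrightarrow>
     (\<exists>t s. black_path T x t \<and> black_path T x s \<and> t 0 = s 0 \<and>
            reaches (Q_plus T d) t \<and> reaches (Q_minus T d) s)"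

section \<open>Oracle Turing machines\<close>

text \<open>A machine has a two-way infinite read-only oracle tape, carrying the oracle on the
  nonnegative cells and blanks on the negative ones, and finitely many two-way infinite work tapes.
  Work tape symbols are natural numbers; \<open>0\<close> is the blank and \<open>1\<close> the stroke. The initial state is
  \<open>0\<close>, and the machine halts where its transition function is \<open>None\<close>. The conditions in \<open>valid_otm\<close>
  ensure that only finitely many arguments of the transition function matter, so a valid machine is
  a finite object.\<close>

datatype head_move = Move_Left | Stay | Move_Right

fun move_head :: "head_move \<Rightarrow> int \<Rightarrow> int" where
  "move_head Move_Left i = i - 1"
| "move_head Stay i = i"
| "move_head Move_Right i = i + 1"

record otm =
  num_states :: nat
  num_symbols :: nat
  num_tapes :: nat
  trans :: "nat \<Rightarrow> bool option \<Rightarrow> nat list \<Rightarrow> (nat \<times> head_move \<times> (nat \<times> head_move) list) option"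

definition valid_otm :: "otm \<Rightarrow> bool" where
  "valid_otm M \<longleftrightarrow> num_states M \<ge> 1 \<and> num_symbols M \<ge> 2 \<and> num_tapes M \<ge> 1 \<and>
     (\<forall>q < num_states M. \<forall>b as q' m acts.
        length as = num_tapes M \<and> (\<forall>a \<in> set as. a < num_symbols M) \<and>
        trans M q b as = Some (q', m, acts) \<longrightarrow>
        q' < num_states M \<and> length acts = num_tapes M \<and> (\<forall>(a, _) \<in> set acts. a < num_symbols M))"

text \<open>A configuration consists of the state, the position of the oracle head, and for each work tape
  the position of its head and its contents.\<close>

type_synonym config = "nat \<times> int \<times> (int \<times> (int \<Rightarrow> nat)) list"

definition oracle_cell :: "(nat \<Rightarrow> bool) \<Rightarrow> int \<Rightarrow> bool option" where
  "oracle_cell x i = (if i < 0 then None else Some (x (nat i)))"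

fun otm_step :: "otm \<Rightarrow> (nat \<Rightarrow> bool) \<Rightarrow> config \<Rightarrow> config option" where
  "otm_step M x (q, h, ws) =
     (case trans M q (oracle_cell x h) (map (\<lambda>(i, w). w i) ws) of
        None \<Rightarrow> None
      | Some (q', m, acts) \<Rightarrow>
          Some (q', move_head m h, map2 (\<lambda>(a, m') (i, w). (move_head m' i, w(i := a))) acts ws))"

text \<open>The argument \<open>a\<close> is written as \<open>a + 1\<close> strokes; successive arguments are separated by a
  blank.\<close>

definition input_tape :: "nat list \<Rightarrow> int \<Rightarrow> nat" where
  "input_tape as i =
     (let l = concat (map (\<lambda>a. replicate (a + 1) 1 @ [0]) as)
      in if 0 \<le> i \<and> nat i < length l then l ! nat i else 0)"

definition otm_init :: "otm \<Rightarrow> nat list \<Rightarrow> config" where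
  "otm_init M as = (0, 0, (0, input_tape as) # replicate (num_tapes M - 1) (0, \<lambda>_. 0))"

text \<open>The output is the total number of strokes on the first work tape, which also held the input.\<close>

fun otm_output :: "config \<Rightarrow> nat" where
  "otm_output (q, h, ws) = card {i. snd (hd ws) i = 1}"

definition otm_yields :: "otm \<Rightarrow> (nat \<Rightarrow> bool) \<Rightarrow> nat list \<Rightarrow> nat \<Rightarrow> bool" where
  "otm_yields M x as m \<longleftrightarrow>
     (\<exists>c. (\<lambda>c c'. otm_step M x c = Some c')\<^sup>*\<^sup>* (otm_init M as) c \<and>
          otm_step M x c = None \<and> otm_output c = m)"

definition computable_fun :: "(nat \<Rightarrow> nat) \<Rightarrow> bool" where
  "computable_fun g \<longleftrightarrow> (\<exists>M. valid_otm M \<and> (\<forall>n. otm_yields M (\<lambda>_. False) [n] (g n)))"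

definition computable_rel :: "nat \<Rightarrow> ((nat \<Rightarrow> bool) \<Rightarrow> nat list \<Rightarrow> bool) \<Rightarrow> bool" where
  "computable_rel k R \<longleftrightarrow>
     (\<exists>M. valid_otm M \<and> (\<forall>x as. length as = k \<longrightarrow> otm_yields M x as (of_bool (R x as))))"

definition computable_functional :: "((nat \<Rightarrow> bool) \<Rightarrow> (nat \<Rightarrow> bool)) \<Rightarrow> bool" where
  "computable_functional f \<longleftrightarrow>
     (\<exists>M. valid_otm M \<and> (\<forall>x n. otm_yields M x [n] (of_bool (f x n))))"

section \<open>Borel and arithmetical hierarchies\<close>

text \<open>Only the levels from \<open>1\<close> on are meaningful.\<close>

fun boldface_Sigma :: "nat \<Rightarrow> 'a::topological_space set set" where
  "boldface_Sigma 0 = {}"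
| "boldface_Sigma (Suc 0) = {A. open A}"
| "boldface_Sigma (Suc (Suc n)) =
     {\<Union>i::nat. - B i | B. \<forall>i. B i \<in> boldface_Sigma (Suc n)}"

text \<open>\<open>exists_prefix n P\<close> is the formula with \<open>n\<close> alternating number quantifiers, starting with an
  existential one, in front of \<open>P [a\<^sub>1, \<dots>, a\<^sub>n]\<close>.\<close>

fun exists_prefix :: "nat \<Rightarrow> (nat list \<Rightarrow> bool) \<Rightarrow> bool"
  and forall_prefix :: "nat \<Rightarrow> (nat list \<Rightarrow> bool) \<Rightarrow> bool" where
  "exists_prefix 0 P = P []"
| "exists_prefix (Suc n) P = (\<exists>a. forall_prefix n (\<lambda>as. P (a # as)))"
| "forall_prefix 0 P = P []"
| "forall_prefix (Suc n) P = (\<forall>a. exists_prefix n (\<lambda>as. P (a # as)))"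

definition lightface_Sigma :: "nat \<Rightarrow> (nat \<Rightarrow> bool) set set" where
  "lightface_Sigma n = {{x. exists_prefix n (R x)} | R. computable_rel n R}"

section \<open>Colorings as points of the Cantor space\<close>

text \<open>Computability of an enumeration refers to the lattice coordinates of the tiles.\<close>

definition computable_enumeration :: "real \<Rightarrow> real \<times> real \<Rightarrow> (nat \<Rightarrow> tile) \<Rightarrow> bool" where
  "computable_enumeration r p e \<longleftrightarrow> bij_betw e UNIV (hex_tiling r p) \<and>
     (\<exists>g. computable_fun g \<and>
          (\<forall>n. e n = hex_tile r p (map_prod int_decode int_decode (prod_decode (g n)))))"

definition coloring_of :: "(nat \<Rightarrow> tile) \<Rightarrow> (nat \<Rightarrow> bool) \<Rightarrow> tile \<Rightarrow> bool" where
  "coloring_of e y t = y (the_inv e t)"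

definition winning_set :: "tile set \<Rightarrow> (int \<Rightarrow> tile) \<Rightarrow> (nat \<Rightarrow> tile) \<Rightarrow> (nat \<Rightarrow> bool) set" where
  "winning_set T d e = {y. winning_for_black T d (coloring_of e y)}"

end

theory Submission
  imports Defs
begin

text \<open>Write membership in a \<open>\<Sigma>\<^sup>0\<^sub>4\<close> set as \<open>\<exists>k. \<forall>m. \<exists>i. \<forall>j. R k m i j\<close>. In lattice coordinates \<open>(t, b)\<close>
  the centre of a tile has horizontal position proportional to \<open>t\<close> and height proportional to
  \<open>t + 2 * b\<close>. The black tiles form pairwise non-adjacent lanes, one for each \<open>K\<close>, lane \<open>K\<close> below lane
  \<open>K + 1\<close>. To the left every lane runs along a diagonal down to minus infinity, so a coloring is winning
  iff some lane tends to plus infinity to the right. A lane moves up diagonally, except that it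
  returns to height about \<open>2 * h\<close> at \<open>t = 2 * l\<close> for the dips \<open>(h, l)\<close>. Lane \<open>K\<close> has a dip \<open>(h, l)\<close> if
  for some \<open>K'\<close> between \<open>K\<close> and \<open>h\<close> and some \<open>c\<close> stage \<open>l\<close> is the first one at which each \<open>k \<le> K'\<close> is
  seen to have some \<open>m \<le> h\<close> for which no \<open>i \<le> c\<close> works. If some \<open>k \<le> K\<close> is a witness, only finitely
  many \<open>c\<close> can occur for each \<open>h\<close> and lane \<open>K\<close> tends to infinity; otherwise lane \<open>K\<close> has infinitely many
  dips at some height \<open>h\<close>. Letting \<open>K'\<close> vary makes the dips decrease with \<open>K\<close>, which keeps the lanes
  apart.

  The color of a tile depends on finitely many values of \<open>R\<close>, which gives continuity. It is even a
  bounded arithmetical formula in \<open>R\<close>. Functions and relations that programs with primitive recursion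
  and with calls of oracle Turing machines as subroutines can compute are closed under
  all constructions of such formulas, and the programs compile to oracle Turing machines, which
  gives computability.\<close>

section \<open>Structured programs for oracle Turing machines\<close>

text \<open>Programs act on tapes seen from the head, so cell \<open>0\<close> is the scanned one and a tape is known
  up to translation. The tapes carry labels of type \<open>'i\<close>; actions on tapes that a machine does not have
  and writings of symbols that it does not know are ignored, which makes every compiled program a
  valid machine.\<close>

type_synonym 'i tapes = "'i \<Rightarrow> int \<Rightarrow> nat"
type_synonym 'i action = "head_move \<times> ('i \<Rightarrow> nat option \<times> head_move)"
type_synonym 'i observation = "bool option \<times> ('i \<Rightarrow> nat)"

definition head_view :: "int \<times> (int \<Rightarrow> nat) \<Rightarrow> int \<Rightarrow> nat" where
  "head_view t = (\<lambda>j. snd t (fst t + j))"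

definition written :: "nat \<Rightarrow> nat option \<Rightarrow> nat \<Rightarrow> nat" where
  "written S a s = (case a of None \<Rightarrow> s | Some s' \<Rightarrow> if s' < S then s' else s)"

definition act_tape :: "nat \<Rightarrow> nat option \<times> head_move \<Rightarrow> (int \<Rightarrow> nat) \<Rightarrow> int \<Rightarrow> nat" where
  "act_tape S a w = (\<lambda>j. (w(0 := written S (fst a) (w 0))) (move_head (snd a) j))"

definition act :: "'i set \<Rightarrow> nat \<Rightarrow> 'i action \<Rightarrow> int \<times> 'i tapes \<Rightarrow> int \<times> 'i tapes" where
  "act I S a c = (move_head (fst a) (fst c),
     \<lambda>i. if i \<in> I then act_tape S (snd a i) (snd c i) else snd c i)"

definition observed :: "'i set \<Rightarrow> (nat \<Rightarrow> bool) \<Rightarrow> int \<times> 'i tapes \<Rightarrow> 'i observation" where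
  "observed I x c = (oracle_cell x (fst c), \<lambda>i. if i \<in> I then snd c i 0 else 0)"

datatype 'i prog =
    Act "'i observation \<Rightarrow> 'i action"
  | Seq "'i prog" "'i prog"
  | While "'i observation \<Rightarrow> bool" "'i prog"

inductive exec ::
  "'i set \<Rightarrow> nat \<Rightarrow> (nat \<Rightarrow> bool) \<Rightarrow> 'i prog \<Rightarrow> int \<times> 'i tapes \<Rightarrow> int \<times> 'i tapes \<Rightarrow> bool"
  for I S x where
  exec_Act: "exec I S x (Act f) c (act I S (f (observed I x c)) c)"
| exec_Seq: "exec I S x p c c' \<Longrightarrow> exec I S x q c' c'' \<Longrightarrow> exec I S x (Seq p q) c c''"
| exec_While_False: "\<not> b (observed I x c) \<Longrightarrow> exec I S x (While b p) c c"
| exec_While_True: "b (observed I x c) \<Longrightarrow> exec I S x p c c' \<Longrightarrow>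
    exec I S x (While b p) c' c'' \<Longrightarrow> exec I S x (While b p) c c''"

lemma exec_ActI: "act I S (f (observed I x c)) c = c' \<Longrightarrow> exec I S x (Act f) c c'"
  using exec_Act by metis

lemma exec_loop:
  assumes "\<And>i. i < m \<Longrightarrow> b (observed I x (\<sigma> i))" "\<And>i. i < m \<Longrightarrow> exec I S x p (\<sigma> i) (\<sigma> (Suc i))"
    and "\<not> b (observed I x (\<sigma> m))"
  shows "exec I S x (While b p) (\<sigma> 0) (\<sigma> m)"
  using assms
proof (induction m arbitrary: \<sigma>)
  case 0
  then show ?case by (intro exec_While_False)
next
  case (Suc m)
  have "exec I S x (While b p) (\<sigma> (Suc 0)) (\<sigma> (Suc m))"
    using Suc.IH[of "\<lambda>i. \<sigma> (Suc i)"] Suc.prems by simp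
  then show ?case using Suc.prems(1,2)[of 0] by (auto intro: exec_While_True)
qed

definition idle :: "'i action" where
  "idle = (Stay, \<lambda>_. (None, Stay))"

lemma act_tape_keep: "act_tape S (None, Stay) w = w"
  by (simp add: act_tape_def written_def)

lemma act_idle: "act I S idle c = c"
  by (cases c) (auto simp: act_def idle_def act_tape_keep fun_eq_iff)

subsection \<open>Compilation\<close>

text \<open>An instruction yields the relative position of the next instruction and an action.\<close>

fun prog_code :: "'i prog \<Rightarrow> ('i observation \<Rightarrow> int \<times> 'i action) list" where
  "prog_code (Act f) = [\<lambda>s. (1, f s)]"
| "prog_code (Seq p q) = prog_code p @ prog_code q"
| "prog_code (While b p) =
     [\<lambda>s. (if b s then 1 else int (length (prog_code p)) + 2, idle)] @ prog_code p @
     [\<lambda>s. (- int (length (prog_code p)) - 1, idle)]"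

definition compiled :: "'i list \<Rightarrow> nat \<Rightarrow> 'i prog \<Rightarrow> otm" where
  "compiled ts S p = \<lparr>num_states = Suc (length (prog_code p)), num_symbols = S,
     num_tapes = length ts,
     trans = \<lambda>q b as. if q < length (prog_code p) then
         (let (j, m, a) = (prog_code p ! q)
            (b, \<lambda>i. case map_of (zip ts as) i of None \<Rightarrow> 0 | Some s \<Rightarrow> s)
          in Some (min (nat (int q + j)) (length (prog_code p)), m,
                   map2 (\<lambda>i s. (written S (fst (a i)) s, snd (a i))) ts as))
       else None\<rparr>"

lemma valid_compiled:
  assumes "ts \<noteq> []" "2 \<le> S"
  shows "valid_otm (compiled ts S p)"
proof -
  have "written S a s < S" if "s < S" for a s
    using that by (auto simp: written_def split: option.split)
  then show ?thesis
    using assms by (cases ts) (auto simp: valid_otm_def compiled_def Let_def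
      split: if_splits prod.splits dest!: set_zip_rightD)
qed

definition runs ::
  "'i list \<Rightarrow> nat \<Rightarrow> 'i prog \<Rightarrow> (nat \<Rightarrow> bool) \<Rightarrow> nat \<Rightarrow> int \<times> 'i tapes \<Rightarrow> nat \<Rightarrow> int \<times> 'i tapes \<Rightarrow> bool"
  where
  "runs ts S p x q c q' c' \<longleftrightarrow> (\<forall>ws. map head_view ws = map (snd c) ts \<longrightarrow>
     (\<exists>ws'. (\<lambda>c c'. otm_step (compiled ts S p) x c = Some c')\<^sup>*\<^sup>* (q, fst c, ws) (q', fst c', ws') \<and>
            map head_view ws' = map (snd c') ts))"

lemma runs_trans:
  "runs ts S p x q c q' c' \<Longrightarrow> runs ts S p x q' c' q'' c'' \<Longrightarrow> runs ts S p x q c q'' c''"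
  unfolding runs_def by (meson rtranclp_trans)

lemma head_view_step:
  "head_view (case t of (i, w) \<Rightarrow> (move_head m i, w(i := a))) =
     (\<lambda>j. ((head_view t)(0 := a)) (move_head m j))"
  by (cases m; cases t) (auto simp: head_view_def fun_eq_iff algebra_simps)

lemma runs_step:
  assumes q: "q < length (prog_code p)"
    and code: "(prog_code p ! q) (observed (set ts) x c) = (j, a)"
    and q': "int q + j = int q'" "q' \<le> length (prog_code p)"
  shows "runs ts S p x q c q' (act (set ts) S a c)"
  unfolding runs_def
proof (intro allI impI)
  fix ws assume ws: "map head_view ws = map (snd c) ts"
  obtain h T where c: "c = (h, T)" by (cases c)
  have len: "length ws = length ts" using ws by (rule map_eq_imp_length_eq)
  have view: "head_view (ws ! k) = T (ts ! k)" if "k < length ts" for k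
    using ws that len unfolding c by (metis nth_map snd_conv)
  have scanned: "map (\<lambda>(i, w). w i) ws = map (\<lambda>i. T i 0) ts"
    using len view[THEN fun_cong, of _ 0]
    by (auto simp: list_eq_iff_nth_eq head_view_def split_beta)
  define acts where "acts = map (\<lambda>i. (written S (fst (snd a i)) (T i 0), snd (snd a i))) ts"
  define ws' where "ws' = map2 (\<lambda>(a, m') (i, w). (move_head m' i, w(i := a))) acts ws"
  have obs: "observed (set ts) x c =
      (oracle_cell x h, \<lambda>i. case map_of (zip ts (map (\<lambda>i. T i 0) ts)) i of None \<Rightarrow> 0 | Some s \<Rightarrow> s)"
    by (auto simp: observed_def c map_of_zip_map)
  have "otm_step (compiled ts S p) x (q, h, ws) = Some (q', move_head (fst a) h, ws')"
    using q code[unfolded obs] q'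
    by (cases a) (simp add: compiled_def scanned ws'_def acts_def zip_map2 zip_same_conv_map
        comp_def)
  moreover have "map head_view ws' = map (snd (act (set ts) S a c)) ts"
    using len view
    by (auto simp: list_eq_iff_nth_eq ws'_def acts_def head_view_step act_def act_tape_def c)
  ultimately show "\<exists>ws'. (\<lambda>c c'. otm_step (compiled ts S p) x c = Some c')\<^sup>*\<^sup>*
      (q, fst c, ws) (q', fst (act (set ts) S a c), ws') \<and>
      map head_view ws' = map (snd (act (set ts) S a c)) ts"
    by (intro exI[of _ ws']) (auto simp: act_def c)
qed

lemma exec_compiled:
  assumes "exec (set ts) S x p0 c c'" "prog_code p = pre @ prog_code p0 @ post"
  shows "runs ts S p x (length pre) c (length pre + length (prog_code p0)) c'"
  using assms
proof (induction arbitrary: pre post rule: exec.induct)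
  case (exec_Act f c)
  then show ?case by (intro runs_step) (auto simp: nth_append)
next
  case (exec_Seq p1 c c' p2 c'')
  have "runs ts S p x (length pre) c (length pre + length (prog_code p1)) c'"
    using exec_Seq.prems by (intro exec_Seq.IH(1)) auto
  moreover have "runs ts S p x (length (pre @ prog_code p1)) c'
      (length (pre @ prog_code p1) + length (prog_code p2)) c''"
    using exec_Seq.prems by (intro exec_Seq.IH(2)) auto
  ultimately show ?case by (auto simp: add.assoc intro: runs_trans)
next
  case (exec_While_False b c p1)
  let ?q = "length pre + length (prog_code (While b p1))"
  have "runs ts S p x (length pre) c ?q (act (set ts) S idle c)"
    using exec_While_False by (intro runs_step) (auto simp: nth_append)
  then show ?case by (simp add: act_idle)
next
  case (exec_While_True b c p1 c' c'')
  let ?l = "length pre" and ?m = "length (prog_code p1)"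
  let ?test = "\<lambda>s. (if b s then 1 else int ?m + 2, idle)"
  have "runs ts S p x ?l c (Suc ?l) (act (set ts) S idle c)"
    using exec_While_True by (intro runs_step) (auto simp: nth_append)
  moreover have "runs ts S p x (length (pre @ [?test])) c (length (pre @ [?test]) + ?m) c'"
    using exec_While_True.prems by (intro exec_While_True.IH(1)) auto
  moreover have "runs ts S p x (Suc ?l + ?m) c' ?l (act (set ts) S idle c')"
    using exec_While_True.prems by (intro runs_step) (auto simp: nth_append)
  moreover have "runs ts S p x ?l c' (?l + length (prog_code (While b p1))) c''"
    using exec_While_True.prems by (intro exec_While_True.IH(2))
  ultimately show ?case by (simp add: act_idle) (blast intro: runs_trans)
qed

lemma card_head_view: "card {j. head_view t j = s} = card {i. snd t i = s}"
proof -
  have "bij_betw (\<lambda>j. fst t + j) {j. head_view t j = s} {i. snd t i = s}"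
    by (rule bij_betwI[where g = "\<lambda>i. i - fst t"]) (auto simp: head_view_def)
  then show ?thesis by (rule bij_betw_same_card)
qed

lemma compiled_yields:
  assumes ex: "exec (set (t # ts)) S x p (0, T) (h', T')"
    and T: "T t = input_tape as" "\<And>i. i \<in> set ts \<Longrightarrow> T i = (\<lambda>_. 0)"
  shows "otm_yields (compiled (t # ts) S p) x as (card {j. T' t j = 1})"
proof -
  let ?M = "compiled (t # ts) S p" and ?ws = "(0, input_tape as) # replicate (length ts) (0, \<lambda>_. 0)"
  have "map head_view ?ws = map T (t # ts)"
    using T by (auto simp: head_view_def map_replicate_const[symmetric])
  moreover have "runs (t # ts) S p x 0 (0, T) (length (prog_code p)) (h', T')"
    using exec_compiled[OF ex, of p "[]" "[]"] by simp
  ultimately obtain ws' where ws': "(\<lambda>c c'. otm_step ?M x c = Some c')\<^sup>*\<^sup>*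
      (0, 0, ?ws) (length (prog_code p), h', ws')" "map head_view ws' = map T' (t # ts)"
    unfolding runs_def fst_conv snd_conv by blast
  moreover have "otm_init ?M as = (0, 0, ?ws)" by (simp add: otm_init_def compiled_def)
  moreover have "otm_step ?M x (length (prog_code p), h', ws') = None" by (simp add: compiled_def)
  moreover have "otm_output (length (prog_code p), h', ws') = card {j. T' t j = 1}"
    using ws'(2) card_head_view[of "hd ws'" 1] by auto
  ultimately show ?thesis unfolding otm_yields_def by metis
qed

section \<open>Stacks of counters\<close>

text \<open>The registers are counters, which change only by moves of the head, and hold a stack of
  numbers. The work tapes and the tape \<open>State\<close> serve to simulate a machine; the tape \<open>Work 0\<close> also
  carries the input and the output.\<close>

datatype tape = State | Work nat | Reg nat

definition tapes :: "nat \<Rightarrow> tape list" where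
  "tapes N = map Work [0..<N] @ State # map Reg [0..<N]"

abbreviation run ::
  "nat \<Rightarrow> (nat \<Rightarrow> bool) \<Rightarrow> tape prog \<Rightarrow> int \<times> tape tapes \<Rightarrow> int \<times> tape tapes \<Rightarrow> bool" where
  "run N \<equiv> exec (set (tapes N)) N"

definition blank :: "int \<Rightarrow> nat" where
  "blank = (\<lambda>_. 0)"

definition counter :: "nat \<Rightarrow> int \<Rightarrow> nat" where
  "counter v = (\<lambda>j. if j = - int v then 2 else 0)"

definition layout :: "nat \<Rightarrow> (nat \<Rightarrow> int \<Rightarrow> nat) \<Rightarrow> (nat \<Rightarrow> nat) \<Rightarrow> tape tapes" where
  "layout q W env t = (case t of State \<Rightarrow> blank(0 := q) | Work j \<Rightarrow> W j | Reg r \<Rightarrow> counter (env r))"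

definition stack :: "nat list \<Rightarrow> nat \<Rightarrow> nat" where
  "stack vs r = (if r < length vs then vs ! r else 0)"

abbreviation store :: "nat list \<Rightarrow> tape tapes" where
  "store vs \<equiv> layout 0 (\<lambda>_. blank) (stack vs)"

lemma tapes_iff [simp]:
  "State \<in> set (tapes N)" "Work j \<in> set (tapes N) \<longleftrightarrow> j < N" "Reg r \<in> set (tapes N) \<longleftrightarrow> r < N"
  by (auto simp: tapes_def)

lemma layout_simps [simp]:
  "layout q W env State = blank(0 := q)" "layout q W env (Work j) = W j"
  "layout q W env (Reg r) = counter (env r)"
  by (simp_all add: layout_def)

lemma blank_upd_0 [simp]: "blank(0 := 0) = blank"
  by (auto simp: blank_def)

lemma stack_update: "r < length vs \<Longrightarrow> stack (vs[r := a]) = (stack vs)(r := a)"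
  by (auto simp: stack_def)

lemma stack_append_zeros: "stack (vs @ replicate k 0) = stack vs"
  by (auto simp: stack_def nth_append)

lemma stack_append_zero [simp]: "stack (vs @ [0]) = stack vs"
  using stack_append_zeros[of vs 1] by simp

fun move_count :: "head_move \<Rightarrow> nat \<Rightarrow> nat" where
  "move_count Move_Left v = v - 1"
| "move_count Stay v = v"
| "move_count Move_Right v = Suc v"

definition layout_action ::
  "head_move \<Rightarrow> nat option \<Rightarrow> (nat \<Rightarrow> nat option \<times> head_move) \<Rightarrow> (nat \<Rightarrow> head_move) \<Rightarrow> tape action" where
  "layout_action m q w f =
     (m, \<lambda>t. case t of State \<Rightarrow> (q, Stay) | Work j \<Rightarrow> w j | Reg r \<Rightarrow> (None, f r))"

lemma act_tape_counter:
  "(m = Move_Left \<Longrightarrow> v \<noteq> 0) \<Longrightarrow> act_tape S (None, m) (counter v) = counter (move_count m v)"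
  by (cases m) (auto simp: act_tape_def written_def counter_def fun_eq_iff)

lemma act_tape_cell:
  "act_tape S (a, Stay) (blank(0 := s)) = blank(0 := written S a s)"
  by (auto simp: act_tape_def blank_def)

lemma act_layoutI:
  assumes "h' = move_head m h" "s' = written N q s"
    and "\<And>j. W' j = (if j < N then act_tape N (w j) (W j) else W j)"
    and "\<And>r. r < N \<Longrightarrow> f r = Move_Left \<Longrightarrow> env r \<noteq> 0"
    and "\<And>r. env' r = (if r < N then move_count (f r) (env r) else env r)"
  shows "act (set (tapes N)) N (layout_action m q w f) (h, layout s W env) = (h', layout s' W' env')"
proof -
  have "act_tape N (None, f r) (counter (env r)) = counter (move_count (f r) (env r))" if "r < N"
    for r using assms(4) that by (intro act_tape_counter) auto
  then show ?thesis
    using assms(1-3,5)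
    by (auto simp: act_def layout_action_def act_tape_cell fun_eq_iff layout_def split: tape.split)
qed

definition nonzero :: "nat \<Rightarrow> tape observation \<Rightarrow> bool" where
  "nonzero r s \<longleftrightarrow> snd s (Reg r) \<noteq> 2"

lemma nonzero_iff: "r < N \<Longrightarrow> nonzero r (observed (set (tapes N)) x (h, layout q W env)) \<longleftrightarrow> env r \<noteq> 0"
  by (simp add: nonzero_def observed_def counter_def)

definition reg_action :: "(nat \<Rightarrow> head_move) \<Rightarrow> tape action" where
  "reg_action f = layout_action Stay None (\<lambda>_. (None, Stay)) f"

lemma act_reg_action:
  assumes "\<And>r. r < N \<Longrightarrow> f r = Move_Left \<Longrightarrow> env r \<noteq> 0"
    and "\<And>r. env' r = (if r < N then move_count (f r) (env r) else env r)"
  shows "act (set (tapes N)) N (reg_action f) (h, layout q W env) = (h, layout q W env')"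
  unfolding reg_action_def
  by (rule act_layoutI) (use assms in \<open>auto simp: written_def act_tape_keep\<close>)

definition io_action :: "nat option \<times> head_move \<Rightarrow> (nat \<Rightarrow> head_move) \<Rightarrow> tape action" where
  "io_action a f = layout_action Stay None (\<lambda>j. if j = 0 then a else (None, Stay)) f"

abbreviation io_layout :: "(int \<Rightarrow> nat) \<Rightarrow> nat list \<Rightarrow> tape tapes" where
  "io_layout w vs \<equiv> layout 0 ((\<lambda>_. blank)(0 := w)) (stack vs)"

lemma act_io_action:
  assumes "0 < N" "act_tape N a w = w'"
    and "\<And>r. r < N \<Longrightarrow> f r = Move_Left \<Longrightarrow> stack vs r \<noteq> 0"
    and "\<And>r. stack vs' r = (if r < N then move_count (f r) (stack vs r) else stack vs r)"
  shows "act (set (tapes N)) N (io_action a f) (h, io_layout w vs) = (h, io_layout w' vs')"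
  unfolding io_action_def
  by (rule act_layoutI) (use assms in \<open>auto simp: written_def act_tape_keep\<close>)

definition inc_prog :: "nat \<Rightarrow> tape prog" where
  "inc_prog r = Act (\<lambda>_. reg_action (\<lambda>i. if i = r then Move_Right else Stay))"

definition transfer_prog :: "nat \<Rightarrow> nat set \<Rightarrow> tape prog" where
  "transfer_prog r I = Act (\<lambda>s. if nonzero r s
     then reg_action (\<lambda>i. if i = r then Move_Left else if i \<in> I then Move_Right else Stay)
     else idle)"

lemma run_inc:
  "r < N \<Longrightarrow> run N x (inc_prog r) (h, layout q W env) (h, layout q W (env(r := Suc (env r))))"
  unfolding inc_prog_def by (intro exec_ActI act_reg_action) (auto split: if_splits)

lemma run_transfer:
  assumes "r < N" "\<And>i. i \<in> I \<Longrightarrow> i < N"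
  shows "run N x (transfer_prog r I) (h, layout q W env)
    (h, layout q W (\<lambda>i. if i = r then env i - 1
      else if i \<in> I \<and> env r \<noteq> 0 then Suc (env i) else env i))"
    (is "run N x _ _ (h, layout q W ?env)")
proof (cases "env r = 0")
  case True
  then have "?env = env" by auto
  then show ?thesis using True assms
    unfolding transfer_prog_def by (intro exec_ActI) (simp add: nonzero_iff act_idle)
next
  case False
  then have "act (set (tapes N)) N
      (reg_action (\<lambda>i. if i = r then Move_Left else if i \<in> I then Move_Right else Stay))
      (h, layout q W env) = (h, layout q W ?env)"
    using assms by (intro act_reg_action) (auto split: if_splits)
  then show ?thesis using False assms
    unfolding transfer_prog_def by (intro exec_ActI) (simp add: nonzero_iff)
qed

subsection \<open>Operations on the stack\<close>

text \<open>The operation need only be correct on sufficiently large machines, so that a program never has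
  to account for the number of tapes and symbols that it uses.\<close>

definition stack_op :: "nat \<Rightarrow> tape prog \<Rightarrow> ((nat \<Rightarrow> bool) \<Rightarrow> nat list \<Rightarrow> nat list) \<Rightarrow> bool" where
  "stack_op n p F \<longleftrightarrow> (\<forall>\<^sub>F N in sequentially. \<forall>x vs. length vs = n \<longrightarrow>
     run N x p (0, store vs) (0, store (F x vs)))"

lemma stack_op_cong:
  assumes "stack_op n p F" "\<And>x vs. length vs = n \<Longrightarrow> stack (F x vs) = stack (G x vs)"
  shows "stack_op n p G"
  using assms unfolding stack_op_def by (auto elim: eventually_mono)

lemma stack_op_push_zeros:
  "stack_op (n + k) p F \<Longrightarrow> stack_op n p (\<lambda>x vs. F x (vs @ replicate k 0))"
  unfolding stack_op_def
  by (erule eventually_mono) (metis length_append length_replicate stack_append_zeros)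

lemma stack_op_skip: "stack_op n (Act (\<lambda>_. idle)) (\<lambda>x vs. vs)"
  unfolding stack_op_def by (auto intro!: always_eventually exec_ActI simp: act_idle)

lemma stack_op_Seq:
  assumes "stack_op n p F" "stack_op m q G" "\<And>x vs. length vs = n \<Longrightarrow> length (F x vs) = m"
  shows "stack_op n (Seq p q) (\<lambda>x vs. G x (F x vs))"
  using assms(1,2) unfolding stack_op_def
  by eventually_elim (use assms(3) in \<open>blast intro: exec_Seq\<close>)

lemma stack_op_while:
  assumes p: "stack_op n p F" and r: "r < n"
    and F: "\<And>x vs. length vs = n \<Longrightarrow> length (F x vs) = n \<and> F x vs ! r = vs ! r - 1"
  shows "stack_op n (While (nonzero r) p) (\<lambda>x vs. (F x ^^ (vs ! r)) vs)"
  using p eventually_gt_at_top[of r] unfolding stack_op_def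
proof eventually_elim
  case (elim N)
  show ?case
  proof (intro allI impI)
    fix x and vs :: "nat list" assume vs: "length vs = n"
    have pow: "length ((F x ^^ i) vs) = n \<and> (F x ^^ i) vs ! r = vs ! r - i" for i
      by (induction i) (use F vs in auto)
    have test: "nonzero r (observed (set (tapes N)) x (0, store ((F x ^^ i) vs))) \<longleftrightarrow> i < vs ! r"
      for i
      using pow[of i] elim(2) r by (auto simp: nonzero_iff stack_def)
    show "run N x (While (nonzero r) p) (0, store vs) (0, store ((F x ^^ (vs ! r)) vs))"
      using exec_loop[where \<sigma> = "\<lambda>i. (0, store ((F x ^^ i) vs))" and m = "vs ! r"] elim(1) pow test
      by simp
  qed
qed

lemma stack_op_inc: "r < n \<Longrightarrow> stack_op n (inc_prog r) (\<lambda>x vs. vs[r := Suc (vs ! r)])"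
  unfolding stack_op_def
  using eventually_gt_at_top[of r]
  by eventually_elim (metis run_inc stack_def stack_update)

definition transferred :: "nat \<Rightarrow> nat set \<Rightarrow> nat \<Rightarrow> nat list \<Rightarrow> nat list" where
  "transferred r I k vs =
     map (\<lambda>i. if i = r then vs ! i - k else if i \<in> I then vs ! i + min k (vs ! r) else vs ! i)
       [0..<length vs]"

lemma transferred_Suc:
  "r < length vs \<Longrightarrow> transferred r I 1 (transferred r I k vs) = transferred r I (Suc k) vs"
  by (rule nth_equalityI) (auto simp: transferred_def)

lemma stack_op_transfer:
  assumes "r < n" "I \<subseteq> {..<n}"
  shows "stack_op n (transfer_prog r I) (\<lambda>x. transferred r I 1)"
  unfolding stack_op_def
  using eventually_ge_at_top[of n]
proof eventually_elim
  case (elim N)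
  have "stack (transferred r I 1 vs) = (\<lambda>i. if i = r then stack vs i - 1
      else if i \<in> I \<and> stack vs r \<noteq> 0 then Suc (stack vs i) else stack vs i)"
    if "length vs = n" for vs
    using that assms by (auto simp: stack_def transferred_def fun_eq_iff)
  moreover have "i < N" if "i \<in> I" for i using that assms(2) elim by auto
  ultimately show ?case using run_transfer[of r N I] assms(1) elim by simp
qed

definition drain_prog :: "nat \<Rightarrow> nat set \<Rightarrow> tape prog" where
  "drain_prog r I = While (nonzero r) (transfer_prog r I)"

definition drained :: "nat \<Rightarrow> nat set \<Rightarrow> nat list \<Rightarrow> nat list" where
  "drained r I vs =
     map (\<lambda>i. if i = r then 0 else if i \<in> I then vs ! i + vs ! r else vs ! i) [0..<length vs]"

lemma stack_op_drain:
  assumes "r < n" "I \<subseteq> {..<n}"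
  shows "stack_op n (drain_prog r I) (\<lambda>x. drained r I)"
proof (rule stack_op_cong)
  show "stack_op n (drain_prog r I) (\<lambda>x vs. (transferred r I 1 ^^ (vs ! r)) vs)"
    unfolding drain_prog_def
    by (rule stack_op_while[OF stack_op_transfer[OF assms]])
      (use assms in \<open>auto simp: transferred_def\<close>)
  fix vs :: "nat list" assume vs: "length vs = n"
  have "(transferred r I 1 ^^ k) vs = transferred r I k vs" for k
  proof (induction k)
    case 0
    show ?case by (auto simp: transferred_def intro!: nth_equalityI)
  next
    case (Suc k)
    then show ?case using transferred_Suc assms vs by simp
  qed
  then show "stack ((transferred r I 1 ^^ (vs ! r)) vs) = stack (drained r I vs)"
    by (simp add: transferred_def drained_def cong: if_cong)
qed

definition push_copy_prog :: "nat \<Rightarrow> nat \<Rightarrow> tape prog" where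
  "push_copy_prog n i = Seq (drain_prog i {n, Suc n}) (drain_prog (Suc n) {i})"

lemma stack_op_push_copy:
  assumes "i < n"
  shows "stack_op n (push_copy_prog n i) (\<lambda>x vs. vs @ [vs ! i])"
proof (rule stack_op_cong)
  have "stack_op (n + 2) (push_copy_prog n i)
      (\<lambda>x vs. drained (Suc n) {i} (drained i {n, Suc n} vs))"
    unfolding push_copy_prog_def
    by (rule stack_op_Seq[where m = "n + 2"]; (rule stack_op_drain)?)
      (use assms in \<open>auto simp: drained_def\<close>)
  then show "stack_op n (push_copy_prog n i)
      (\<lambda>x vs. drained (Suc n) {i} (drained i {n, Suc n} (vs @ replicate 2 0)))"
    by (rule stack_op_push_zeros)
  fix vs :: "nat list" assume "length vs = n"
  then show "stack (drained (Suc n) {i} (drained i {n, Suc n} (vs @ replicate 2 0))) =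
      stack (vs @ [vs ! i])"
    using assms by (auto simp: stack_def drained_def nth_append fun_eq_iff less_Suc_eq)
qed

section \<open>Calling an oracle Turing machine as a subroutine\<close>

text \<open>The two registers above the arguments are timers. As they count the symbols written and the
  steps simulated, they bound the distance of the nonblank cells from the heads; this makes it possible
  to erase the work tapes after the simulation, while counting the strokes of the output.\<close>

subsection \<open>Writing the arguments\<close>

text \<open>The arguments are written from right to left, so that the head ends at their start.\<close>

definition pushed :: "nat list \<Rightarrow> int \<Rightarrow> nat" where
  "pushed L = (\<lambda>j. if 1 \<le> j \<and> nat (j - 1) < length L then L ! nat (j - 1) else 0)"

definition encoded :: "nat list \<Rightarrow> nat list" where
  "encoded as = concat (map (\<lambda>a. replicate (a + 1) 1 @ [0]) as)"

definition timer_moves :: "nat \<Rightarrow> nat \<Rightarrow> head_move" where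
  "timer_moves t i = (if i = t \<or> i = Suc t then Move_Right else Stay)"

definition push_prog :: "nat \<Rightarrow> (nat \<Rightarrow> head_move) \<Rightarrow> tape prog" where
  "push_prog a f = Act (\<lambda>_. io_action (Some a, Move_Left) f)"

definition write_arg :: "nat \<Rightarrow> nat \<Rightarrow> tape prog" where
  "write_arg t r = Seq (push_prog 0 (timer_moves t)) (Seq (push_prog 1 (timer_moves t))
     (While (nonzero r) (push_prog 1 ((timer_moves t)(r := Move_Left)))))"

fun write_args :: "nat \<Rightarrow> nat \<Rightarrow> nat \<Rightarrow> tape prog" where
  "write_args t r 0 = Act (\<lambda>_. idle)"
| "write_args t r (Suc m) = Seq (write_arg t (r + m)) (write_args t r m)"

text \<open>The second timer is one ahead, as \<open>2 * B + 1\<close> cells lie within distance \<open>B\<close> of the head.\<close>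

abbreviation arg_layout :: "nat list \<Rightarrow> nat list \<Rightarrow> nat \<Rightarrow> tape tapes" where
  "arg_layout L vs B \<equiv> io_layout (pushed L) (vs @ [B, Suc B])"

lemma pushed_Nil [simp]: "pushed [] = blank"
  by (auto simp: pushed_def blank_def)

lemma act_tape_push: "a < S \<Longrightarrow> act_tape S (Some a, Move_Left) (pushed L) = pushed (a # L)"
  by (auto simp: act_tape_def written_def pushed_def fun_eq_iff nth_Cons' nat_diff_distrib
      intro!: arg_cong[where f = "(!) L"])

lemma run_push:
  assumes "a < N" and N: "Suc (length vs) < N" and len: "length vs' = length vs"
    and f: "\<And>r. f r = Move_Left \<Longrightarrow> r < length vs \<and> vs ! r \<noteq> 0" "f (length vs) = Move_Right"
      "f (Suc (length vs)) = Move_Right" "\<And>r. Suc (length vs) < r \<Longrightarrow> f r = Stay"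
    and vs': "\<And>r. r < length vs \<Longrightarrow> vs' ! r = move_count (f r) (vs ! r)"
  shows "run N x (push_prog a f) (h, arg_layout L vs B) (h, arg_layout (a # L) vs' (Suc B))"
  unfolding push_prog_def
proof (intro exec_ActI act_io_action)
  let ?env = "stack (vs @ [B, Suc B])"
  fix r
  show "?env r \<noteq> 0" if "f r = Move_Left" using f(1)[OF that] by (simp add: stack_def nth_append)
  consider "r < length vs" | "r = length vs" | "r = Suc (length vs)" | "Suc (length vs) < r"
    by linarith
  then show "stack (vs' @ [Suc B, Suc (Suc B)]) r =
      (if r < N then move_count (f r) (?env r) else ?env r)"
    using N len f(2-4) vs' by cases (auto simp: stack_def nth_append)
qed (use assms in \<open>simp_all add: act_tape_push\<close>)

lemma run_write_arg:
  assumes r: "r < length vs" and N: "Suc (length vs) < N"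
  shows "run N x (write_arg (length vs) r) (h, arg_layout L vs B)
    (h, arg_layout (encoded [vs ! r] @ L) (vs[r := 0]) (B + length (encoded [vs ! r])))"
proof -
  let ?t = "length vs" and ?v = "vs ! r"
  let ?f = "(timer_moves ?t)(r := Move_Left)"
  have push: "run N x (push_prog a (timer_moves ?t)) (h, arg_layout L vs B)
      (h, arg_layout (a # L) vs (Suc B))" if "a \<le> 1" for a L B
    using that N by (intro run_push) (auto simp: timer_moves_def split: if_splits)
  define \<sigma> where
    "\<sigma> i = (h, arg_layout (replicate i 1 @ 1 # 0 # L) (vs[r := ?v - i]) (Suc (Suc (B + i))))" for i
  have "run N x (While (nonzero r) (push_prog 1 ?f)) (\<sigma> 0) (\<sigma> ?v)"
  proof (rule exec_loop)
    have test: "nonzero r (observed (set (tapes N)) x (\<sigma> i)) \<longleftrightarrow> i < ?v" for i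
      using r N by (auto simp: \<sigma>_def nonzero_iff stack_def nth_append)
    then show "nonzero r (observed (set (tapes N)) x (\<sigma> i))" if "i < ?v" for i using that by simp
    show "\<not> nonzero r (observed (set (tapes N)) x (\<sigma> ?v))" using test by simp
    show "run N x (push_prog 1 ?f) (\<sigma> i) (\<sigma> (Suc i))" if i: "i < ?v" for i
      unfolding \<sigma>_def replicate_Suc append_Cons add_Suc_right
    proof (rule run_push)
      show "vs[r := ?v - Suc i] ! k = move_count (?f k) (vs[r := ?v - i] ! k)"
        if "k < length (vs[r := ?v - i])" for k
        using that r i by (auto simp: nth_list_update timer_moves_def)
    qed (use r N i in \<open>auto simp: timer_moves_def split: if_splits\<close>)
  qed
  moreover have "\<sigma> 0 = (h, arg_layout (1 # 0 # L) vs (Suc (Suc B)))"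
    by (simp add: \<sigma>_def)
  moreover have "\<sigma> ?v = (h, arg_layout (encoded [?v] @ L) (vs[r := 0]) (B + length (encoded [?v])))"
    by (simp add: \<sigma>_def encoded_def replicate_app_Cons_same)
  ultimately have loop: "run N x (While (nonzero r) (push_prog 1 ?f))
      (h, arg_layout (1 # 0 # L) vs (Suc (Suc B)))
      (h, arg_layout (encoded [?v] @ L) (vs[r := 0]) (B + length (encoded [?v])))" by simp
  show ?thesis
    unfolding write_arg_def by (rule exec_Seq[OF push exec_Seq[OF push loop]]) simp_all
qed

lemma run_write_args:
  assumes "Suc t < N" "t = length vs + length as + k"
  shows "run N x (write_args t (length vs) (length as))
    (h, arg_layout L (vs @ as @ replicate k 0) B)
    (h, arg_layout (encoded as @ L) (vs @ replicate (length as + k) 0) (B + length (encoded as)))"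
  using assms
proof (induction as arbitrary: L B k rule: rev_induct)
  case Nil
  then show ?case by (auto intro!: exec_ActI simp: act_idle encoded_def)
next
  case (snoc a as)
  let ?vs = "vs @ (as @ [a]) @ replicate k 0"
  let ?L = "encoded [a] @ L" and ?B = "B + length (encoded [a])"
  have "?vs[length vs + length as := 0] = vs @ as @ replicate (Suc k) 0"
    "?vs ! (length vs + length as) = a"
    by (simp_all add: list_update_append nth_append)
  then have "run N x (write_arg t (length vs + length as)) (h, arg_layout L ?vs B)
      (h, arg_layout ?L (vs @ as @ replicate (Suc k) 0) ?B)"
    using run_write_arg[of "length vs + length as" ?vs N x h L B] snoc.prems
    by (simp del: append_assoc add: add.assoc)
  moreover have "run N x (write_args t (length vs) (length as))
      (h, arg_layout ?L (vs @ as @ replicate (Suc k) 0) ?B)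
      (h, arg_layout (encoded as @ ?L) (vs @ replicate (length as + Suc k) 0)
        (?B + length (encoded as)))"
    using snoc.prems by (intro snoc.IH) auto
  ultimately have "run N x (write_args t (length vs) (length (as @ [a]))) (h, arg_layout L ?vs B)
      (h, arg_layout (encoded as @ ?L) (vs @ replicate (length as + Suc k) 0)
        (?B + length (encoded as)))"
    by (auto intro: exec_Seq)
  moreover have "encoded as @ ?L = encoded (as @ [a]) @ L"
    "?B + length (encoded as) = B + length (encoded (as @ [a]))"
    "length as + Suc k = length (as @ [a]) + k"
    by (simp_all add: encoded_def)
  ultimately show ?case by (simp only:)
qed

subsection \<open>Simulation\<close>

definition work :: "(int \<times> (int \<Rightarrow> nat)) list \<Rightarrow> nat \<Rightarrow> int \<Rightarrow> nat" where
  "work ws j = (if j < length ws then head_view (ws ! j) else blank)"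

definition tape_bounded :: "nat \<Rightarrow> nat \<Rightarrow> (int \<Rightarrow> nat) \<Rightarrow> bool" where
  "tape_bounded s B w \<longleftrightarrow> (\<forall>j. w j < s \<and> (w j \<noteq> 0 \<longrightarrow> \<bar>j\<bar> \<le> int B))"

fun config_bounded :: "otm \<Rightarrow> nat \<Rightarrow> config \<Rightarrow> bool" where
  "config_bounded M B (q, h, ws) \<longleftrightarrow> q < num_states M \<and> length ws = num_tapes M \<and>
     (\<forall>j. tape_bounded (num_symbols M) B (work ws j))"

definition sim_trans ::
    "otm \<Rightarrow> (bool option \<Rightarrow> bool option) \<Rightarrow> tape observation \<Rightarrow>
      (nat \<times> head_move \<times> (nat \<times> head_move) list) option" where
  "sim_trans M \<phi> s =
     trans M (snd s State) (\<phi> (fst s)) (map (\<lambda>j. snd s (Work j)) [0..<num_tapes M])"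

definition sim_action ::
    "otm \<Rightarrow> (bool option \<Rightarrow> bool option) \<Rightarrow> nat \<Rightarrow> tape observation \<Rightarrow> tape action" where
  "sim_action M \<phi> t s = (case sim_trans M \<phi> s of
     None \<Rightarrow> idle
   | Some (q, m, acts) \<Rightarrow> layout_action m (Some q)
       (\<lambda>j. if j < length acts then apfst Some (acts ! j) else (None, Stay)) (timer_moves t))"

definition sim_prog :: "otm \<Rightarrow> (bool option \<Rightarrow> bool option) \<Rightarrow> nat \<Rightarrow> tape prog" where
  "sim_prog M \<phi> t = While (\<lambda>s. sim_trans M \<phi> s \<noteq> None) (Act (sim_action M \<phi> t))"

lemma scanned_work:
  "length ws = n \<Longrightarrow> map (\<lambda>(i, w). w i) ws = map (\<lambda>j. work ws j 0) [0..<n]"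
  by (auto simp: work_def head_view_def split_beta intro!: nth_equalityI)

lemma tape_bounded_act:
  assumes "tape_bounded s B w" "a < s" "s \<le> S"
  shows "tape_bounded s (Suc B) (act_tape S (Some a, m) w)"
  unfolding tape_bounded_def
proof
  fix j
  have w: "w i < s \<and> (w i \<noteq> 0 \<longrightarrow> \<bar>i\<bar> \<le> int B)" for i using assms(1) by (simp add: tape_bounded_def)
  have "\<bar>j - move_head m j\<bar> \<le> 1" by (cases m) auto
  then show "act_tape S (Some a, m) w j < s \<and>
      (act_tape S (Some a, m) w j \<noteq> 0 \<longrightarrow> \<bar>j\<bar> \<le> int (Suc B))"
    using assms(2,3) w[of "move_head m j"] by (auto simp: act_tape_def written_def)
qed

lemma otm_step_bounded:
  assumes M: "valid_otm M" "num_symbols M \<le> S" and c: "config_bounded M B (q, h, ws)"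
    and step: "otm_step M y (q, h, ws) = Some (q', h', ws')"
  obtains m acts where
    "trans M q (oracle_cell y h) (map (\<lambda>j. work ws j 0) [0..<num_tapes M]) = Some (q', m, acts)"
    "h' = move_head m h" "length acts = num_tapes M"
    "\<And>j. work ws' j =
      (if j < num_tapes M then act_tape S (apfst Some (acts ! j)) (work ws j) else blank)"
    "config_bounded M (Suc B) (q', h', ws')"
proof -
  have len: "length ws = num_tapes M" and q: "q < num_states M"
    and bounded: "\<And>j. tape_bounded (num_symbols M) B (work ws j)"
    using c by auto
  let ?as = "map (\<lambda>j. work ws j 0) [0..<num_tapes M]"
  obtain m acts where tr: "trans M q (oracle_cell y h) ?as = Some (q', m, acts)"
    and h': "h' = move_head m h"
    and ws': "ws' = map2 (\<lambda>(a, m') (i, w). (move_head m' i, w(i := a))) acts ws"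
    using step by (auto simp: scanned_work[OF len] split: option.splits)
  have "length ?as = num_tapes M" "\<forall>a\<in>set ?as. a < num_symbols M"
    using bounded by (auto simp: tape_bounded_def)
  then have acts: "q' < num_states M" "length acts = num_tapes M"
      "\<forall>(a, _) \<in> set acts. a < num_symbols M"
    using M(1) q tr unfolding valid_otm_def by blast+
  then have sym: "fst (acts ! j) < num_symbols M" if "j < num_tapes M" for j
    using that by (auto simp: all_set_conv_all_nth split_beta)
  have work': "work ws' j =
      (if j < num_tapes M then act_tape S (apfst Some (acts ! j)) (work ws j) else blank)" for j
    using sym[of j] M(2) len acts(2) head_view_step[of "snd (acts ! j)" "fst (acts ! j)" "ws ! j"]
    by (auto simp: work_def ws' act_tape_def written_def split_beta)
  have "tape_bounded (num_symbols M) (Suc B) (work ws' j)" for j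
  proof (cases "j < num_tapes M")
    case True
    then show ?thesis
      using tape_bounded_act[OF bounded[of j] sym M(2), of j "snd (acts ! j)"]
      by (simp add: work' apfst_def map_prod_def split_beta)
  next
    case False
    moreover have "0 < num_symbols M" using bounded[of j] by (auto simp: tape_bounded_def)
    ultimately show ?thesis by (simp add: work' tape_bounded_def blank_def)
  qed
  then have "config_bounded M (Suc B) (q', h', ws')" using acts len by (simp add: ws')
  with that tr h' acts(2) work' show thesis by blast
qed

lemma config_bounded_steps:
  assumes M: "valid_otm M" and "config_bounded M B (f 0)"
    and f: "\<And>i. i < n \<Longrightarrow> otm_step M y (f i) = Some (f (Suc i))"
  shows "config_bounded M (B + n) (f n)"
  using assms(2,3)
proof (induction n)
  case (Suc n)
  obtain q h ws q' h' ws' where fn: "f n = (q, h, ws)" "f (Suc n) = (q', h', ws')"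
    by (metis prod_cases3)
  have "config_bounded M (B + n) (q, h, ws)" using Suc fn(1) by simp
  moreover have "otm_step M y (q, h, ws) = Some (q', h', ws')" using Suc.prems(2)[of n] fn by simp
  ultimately have "config_bounded M (Suc (B + n)) (q', h', ws')"
    by (rule otm_step_bounded[OF M order_refl])
  then show ?case using fn(2) by simp
qed simp

locale simulation =
  fixes N :: nat and M :: otm and \<phi> :: "bool option \<Rightarrow> bool option" and x y :: "nat \<Rightarrow> bool"
  assumes M: "valid_otm M" "num_states M \<le> N" "num_symbols M \<le> N" "num_tapes M \<le> N"
    and oracle_eq: "\<And>h. oracle_cell y h = \<phi> (oracle_cell x h)"
begin

lemma sim_trans_observed:
  assumes "q < num_states M"
  shows "sim_trans M \<phi> (observed (set (tapes N)) x (h, layout q (work ws) env)) =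
    trans M q (oracle_cell y h) (map (\<lambda>j. work ws j 0) [0..<num_tapes M])"
  using M(4)
  by (auto simp: sim_trans_def observed_def oracle_eq intro!: arg_cong[where f = "trans M q _"])

lemma sim_trans_None_iff:
  assumes "config_bounded M B (q, h, ws)"
  shows "sim_trans M \<phi> (observed (set (tapes N)) x (h, layout q (work ws) env)) = None \<longleftrightarrow>
    otm_step M y (q, h, ws) = None"
  using assms
  by (simp add: sim_trans_observed scanned_work[of ws "num_tapes M"] split: option.split)

lemma run_sim_step:
  assumes N: "Suc (length vs) < N" and c: "config_bounded M B (q, h, ws)"
    and step: "otm_step M y (q, h, ws) = Some (q', h', ws')"
  shows "run N x (Act (sim_action M \<phi> (length vs)))
    (h, layout q (work ws) (stack (vs @ [B, Suc B])))
    (h', layout q' (work ws') (stack (vs @ [Suc B, Suc (Suc B)])))"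
proof (rule exec_ActI)
  obtain m acts where
    tr: "trans M q (oracle_cell y h) (map (\<lambda>j. work ws j 0) [0..<num_tapes M]) = Some (q', m, acts)"
    and h': "h' = move_head m h" and acts: "length acts = num_tapes M"
    and work': "\<And>j. work ws' j =
      (if j < num_tapes M then act_tape N (apfst Some (acts ! j)) (work ws j) else blank)"
    and c': "config_bounded M (Suc B) (q', h', ws')"
    by (rule otm_step_bounded[OF M(1,3) c step]) (rule that)
  let ?w = "\<lambda>j. if j < length acts then apfst Some (acts ! j) else (None, Stay)"
  let ?env = "stack (vs @ [B, Suc B])"
  have "sim_action M \<phi> (length vs) (observed (set (tapes N)) x (h, layout q (work ws) ?env)) =
      layout_action m (Some q') ?w (timer_moves (length vs))"
    using c tr by (simp add: sim_action_def sim_trans_observed)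
  moreover have "work ws j = blank" if "\<not> j < num_tapes M" for j
    using c that by (simp add: work_def)
  then have "act (set (tapes N)) N (layout_action m (Some q') ?w (timer_moves (length vs)))
      (h, layout q (work ws) ?env) = (h', layout q' (work ws') (stack (vs @ [Suc B, Suc (Suc B)])))"
    using N c' M(2,4) h' work' acts
    by (intro act_layoutI)
      (auto simp: written_def act_tape_keep timer_moves_def stack_def nth_append split: if_splits)
  ultimately show "act (set (tapes N)) N
      (sim_action M \<phi> (length vs) (observed (set (tapes N)) x (h, layout q (work ws) ?env)))
      (h, layout q (work ws) ?env) = (h', layout q' (work ws') (stack (vs @ [Suc B, Suc (Suc B)])))"
    by simp
qed

lemma run_sim_prog:
  assumes N: "Suc (length vs) < N" and c: "config_bounded M B (q, h, ws)"
    and steps: "(\<lambda>c c'. otm_step M y c = Some c')\<^sup>*\<^sup>* (q, h, ws) (q', h', ws')"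
    and halt: "otm_step M y (q', h', ws') = None"
  obtains B' where "config_bounded M B' (q', h', ws')"
    "run N x (sim_prog M \<phi> (length vs)) (h, layout q (work ws) (stack (vs @ [B, Suc B])))
       (h', layout q' (work ws') (stack (vs @ [B', Suc B'])))"
proof -
  obtain n f where f: "f 0 = (q, h, ws)" "f n = (q', h', ws')"
    "\<And>i. i < n \<Longrightarrow> otm_step M y (f i) = Some (f (Suc i))"
    using steps unfolding rtranclp_power relpowp_fun_conv by blast
  have bounded: "config_bounded M (B + i) (f i)" if "i \<le> n" for i
    using f that c by (intro config_bounded_steps[OF M(1), where y = y]) auto
  define \<sigma> where "\<sigma> i = (case f i of (q, h, ws) \<Rightarrow>
      (h, layout q (work ws) (stack (vs @ [B + i, Suc (B + i)]))))" for i
  have test: "sim_trans M \<phi> (observed (set (tapes N)) x (\<sigma> i)) = None \<longleftrightarrow> otm_step M y (f i) = None"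
    if "i \<le> n" for i
    using bounded[OF that] by (cases "f i") (auto simp: \<sigma>_def sim_trans_None_iff)
  have "run N x (sim_prog M \<phi> (length vs)) (\<sigma> 0) (\<sigma> n)"
    unfolding sim_prog_def
  proof (rule exec_loop)
    fix i assume i: "i < n"
    show "sim_trans M \<phi> (observed (set (tapes N)) x (\<sigma> i)) \<noteq> None" using test[of i] f(3) i by simp
    show "run N x (Act (sim_action M \<phi> (length vs))) (\<sigma> i) (\<sigma> (Suc i))"
      using run_sim_step[OF N, of "B + i"] bounded[of i] f(3)[OF i] i
      by (cases "f i"; cases "f (Suc i)") (simp add: \<sigma>_def)
  qed (use test[of n] f(2) halt in simp)
  then show thesis using that[of "B + n"] bounded[of n] f(1,2) by (simp add: \<sigma>_def)
qed

end

subsection \<open>Erasing the work tapes\<close>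

definition rewind_prog :: "nat \<Rightarrow> tape prog" where
  "rewind_prog t = While (nonzero t) (Act (\<lambda>_. layout_action Stay None (\<lambda>_. (None, Move_Right))
     ((timer_moves t)(t := Move_Left))))"

definition sweep_moves :: "nat \<Rightarrow> nat \<Rightarrow> bool \<Rightarrow> nat \<Rightarrow> head_move" where
  "sweep_moves r t stroke i =
     (if i = Suc t then Move_Left else if i = r \<and> stroke then Move_Right else Stay)"

definition sweep_prog :: "nat \<Rightarrow> nat \<Rightarrow> tape prog" where
  "sweep_prog r t = While (nonzero (Suc t)) (Act (\<lambda>s. layout_action Stay None
     (\<lambda>_. (Some 0, Move_Left)) (sweep_moves r t (snd s (Work 0) = 1))))"

definition swept :: "nat \<Rightarrow> (int \<Rightarrow> nat) \<Rightarrow> int \<Rightarrow> nat" where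
  "swept i w = (\<lambda>j. if j \<le> 0 then w (j - int i) else 0)"

lemma act_tape_right: "act_tape S (None, Move_Right) w = (\<lambda>j. w (j + 1))"
  by (simp add: act_tape_def written_def)

lemma act_tape_sweep: "0 < S \<Longrightarrow> act_tape S (Some 0, Move_Left) (swept i w) = swept (Suc i) w"
  by (auto simp: act_tape_def written_def swept_def fun_eq_iff algebra_simps)

lemma swept_blank: "swept i blank = blank"
  by (simp add: swept_def blank_def)

lemma run_rewind:
  assumes N: "Suc (length vs) < N" and W: "\<And>j. N \<le> j \<Longrightarrow> W j = blank"
  shows "run N x (rewind_prog (length vs)) (h, layout q W (stack (vs @ [B, Suc B])))
    (h, layout q (\<lambda>j i. W j (i + int B)) (stack (vs @ [0, Suc (2 * B)])))"
proof -
  let ?t = "length vs"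
  define env where "env i = stack (vs @ [B - i, Suc (B + i)])" for i
  define \<sigma> where "\<sigma> i = (h, layout q (\<lambda>j k. W j (k + int i)) (env i))" for i
  have "run N x (rewind_prog ?t) (\<sigma> 0) (\<sigma> B)"
    unfolding rewind_prog_def
  proof (rule exec_loop)
    fix i assume i: "i < B"
    show "nonzero ?t (observed (set (tapes N)) x (\<sigma> i))"
      using i N by (simp add: \<sigma>_def env_def nonzero_iff stack_def nth_append)
    show "run N x (Act (\<lambda>_. layout_action Stay None (\<lambda>_. (None, Move_Right))
        ((timer_moves ?t)(?t := Move_Left)))) (\<sigma> i) (\<sigma> (Suc i))"
      unfolding \<sigma>_def
    proof (intro exec_ActI act_layoutI)
      show "(\<lambda>k. W j (k + int (Suc i))) = (if j < N
          then act_tape N (None, Move_Right) (\<lambda>k. W j (k + int i)) else (\<lambda>k. W j (k + int i)))" for j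
        using W[of j] by (auto simp: act_tape_right add_ac blank_def)
    qed (use i N in \<open>auto simp: written_def env_def timer_moves_def stack_def nth_append
        split: if_splits\<close>)
  qed (use N in \<open>simp add: \<sigma>_def env_def nonzero_iff stack_def nth_append\<close>)
  then show ?thesis by (simp add: \<sigma>_def env_def mult_2)
qed

lemma run_sweep:
  assumes N: "Suc t < N" and r: "r \<le> t"
    and W: "\<And>j. N \<le> j \<Longrightarrow> W j = blank" "\<And>j k. 0 < k \<Longrightarrow> W j k = 0"
  shows "run N x (sweep_prog r t) (h, layout q W (env(r := 0, Suc t := n)))
    (h, layout q (\<lambda>j. swept n (W j)) (env(r := \<Sum>k<n. of_bool (W 0 (- int k) = 1), Suc t := 0)))"
proof -
  define c where "c i = (\<Sum>k<i. of_bool (W 0 (- int k) = 1) :: nat)" for i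
  define \<sigma> where "\<sigma> i = (h, layout q (\<lambda>j. swept i (W j)) (env(r := c i, Suc t := n - i)))" for i
  have "run N x (sweep_prog r t) (\<sigma> 0) (\<sigma> n)"
    unfolding sweep_prog_def
  proof (rule exec_loop)
    fix i assume i: "i < n"
    show "nonzero (Suc t) (observed (set (tapes N)) x (\<sigma> i))"
      using i N by (simp add: \<sigma>_def nonzero_iff)
    have scanned: "snd (observed (set (tapes N)) x (\<sigma> i)) (Work 0) = W 0 (- int i)"
      using N by (simp add: observed_def \<sigma>_def swept_def)
    have "act (set (tapes N)) N (layout_action Stay None (\<lambda>_. (Some 0, Move_Left))
        (sweep_moves r t (W 0 (- int i) = 1))) (\<sigma> i) = \<sigma> (Suc i)"
      unfolding \<sigma>_def using N r W(1) i
      by (intro act_layoutI) (auto simp: written_def act_tape_sweep swept_blank not_less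
          sweep_moves_def c_def split: if_splits)
    then show "run N x (Act (\<lambda>s. layout_action Stay None (\<lambda>_. (Some 0, Move_Left))
        (sweep_moves r t (snd s (Work 0) = 1)))) (\<sigma> i) (\<sigma> (Suc i))"
      by (intro exec_ActI) (simp only: scanned)
  qed (use N in \<open>simp add: \<sigma>_def nonzero_iff\<close>)
  moreover have "swept 0 (W j) = W j" for j
    using W(2)[of _ j] by (auto simp: swept_def fun_eq_iff)
  ultimately show ?thesis by (simp add: \<sigma>_def c_def)
qed

lemma sum_of_bool_strokes:
  fixes w :: "int \<Rightarrow> nat"
  assumes "\<And>k. w k \<noteq> 0 \<Longrightarrow> - int n < k \<and> k \<le> 0"
  shows "(\<Sum>k<n. of_bool (w (- int k) = 1)) = card {k. w k = 1}"
proof -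
  have range: "- int n < k \<and> k \<le> 0" if "w k = 1" for k
    by (rule assms) (simp add: that)
  have "bij_betw (\<lambda>k. - int k) {k. k < n \<and> w (- int k) = 1} {k. w k = 1}"
  proof (rule bij_betwI[where g = "\<lambda>k. nat (- k)"])
    show "(\<lambda>k. nat (- k)) \<in> {k. w k = 1} \<rightarrow> {k. k < n \<and> w (- int k) = 1}"
      using range by force
    show "- int (nat (- k)) = k" if "k \<in> {k. w k = 1}" for k
      using range[of k] that by simp
  qed auto
  moreover have "(\<Sum>k<n. of_bool (w (- int k) = 1)) = card {k. k < n \<and> w (- int k) = 1}"
    by (simp add: sum.If_cases of_bool_def Int_def)
  ultimately show ?thesis by (simp add: bij_betw_same_card)
qed

lemma run_erase:
  assumes N: "Suc (length vs) < N" and r: "r \<le> length vs" "stack vs r = 0"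
    and W: "\<And>j. N \<le> j \<Longrightarrow> W j = blank" "\<And>j. tape_bounded s B (W j)"
  shows "run N x (Seq (rewind_prog (length vs)) (sweep_prog r (length vs)))
    (h, layout q W (stack (vs @ [B, Suc B])))
    (h, layout q (\<lambda>_. blank) ((stack vs)(r := card {j. W 0 j = 1})))"
proof -
  let ?t = "length vs" and ?n = "Suc (2 * B)" and ?W = "\<lambda>j i. W j (i + int B)"
  have within: "- int ?n < k \<and> k \<le> 0" if "?W j k \<noteq> 0" for j k
  proof -
    have "\<bar>k + int B\<bar> \<le> int B" using W(2) that by (simp add: tape_bounded_def)
    then show ?thesis by linarith
  qed
  have "stack (vs @ [0, ?n]) = (stack vs)(r := 0, Suc ?t := ?n)"
    using r by (auto simp: stack_def nth_append fun_eq_iff less_Suc_eq)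
  with run_rewind[OF N W(1), where x = x and h = h and q = q and B = B]
  have rewind: "run N x (rewind_prog ?t) (h, layout q W (stack (vs @ [B, Suc B])))
      (h, layout q ?W ((stack vs)(r := 0, Suc ?t := ?n)))" by simp
  have blank_right: "?W j k = 0" if "0 < k" for j k using within[of j k] that by linarith
  have swept: "(\<lambda>j. swept ?n (?W j)) = (\<lambda>_. blank)"
  proof (intro ext)
    show "swept ?n (?W j) i = blank i" for j i
      using within[of j "i - int ?n"]
      by (cases "?W j (i - int ?n) = 0") (auto simp: swept_def blank_def)
  qed
  have "(\<Sum>k<?n. of_bool (?W 0 (- int k) = 1)) = card {k. ?W 0 k = 1}"
    by (rule sum_of_bool_strokes) (rule within)
  also have "\<dots> = card {j. W 0 j = 1}"
    by (rule bij_betw_same_card[of "\<lambda>k. k + int B"], rule bij_betwI[where g = "\<lambda>j. j - int B"]) auto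
  finally have count: "(\<Sum>k<?n. of_bool (?W 0 (- int k) = 1)) = card {j. W 0 j = 1}" .
  have timer: "(stack vs)(r := a, Suc ?t := 0) = (stack vs)(r := a)" for a
    using r(1) by (auto simp: stack_def fun_eq_iff)
  have "run N x (sweep_prog r ?t) (h, layout q ?W ((stack vs)(r := 0, Suc ?t := ?n)))
      (h, layout q (\<lambda>j. swept ?n (?W j))
        ((stack vs)(r := \<Sum>k<?n. of_bool (?W 0 (- int k) = 1), Suc ?t := 0)))"
    by (rule run_sweep[OF N r(1)]) (use W(1) blank_right in \<open>auto simp: blank_def\<close>)
  with rewind show ?thesis unfolding swept count timer by (rule exec_Seq)
qed

subsection \<open>The call\<close>

definition oracle_prog :: "head_move \<Rightarrow> tape prog" where
  "oracle_prog m = Act (\<lambda>_. layout_action m None (\<lambda>_. (None, Stay)) (\<lambda>_. Stay))"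

definition reset_oracle :: "tape prog" where
  "reset_oracle = Seq (While (\<lambda>s. fst s = None) (oracle_prog Move_Right))
     (Seq (While (\<lambda>s. fst s \<noteq> None) (oracle_prog Move_Left)) (oracle_prog Move_Right))"

definition start_prog :: "nat \<Rightarrow> nat \<Rightarrow> tape prog" where
  "start_prog r m = Seq (inc_prog (Suc (r + m))) (Seq (write_args (r + m) r m)
     (Act (\<lambda>_. io_action (None, Move_Right) (\<lambda>_. Stay))))"

definition finish_prog :: "nat \<Rightarrow> nat \<Rightarrow> tape prog" where
  "finish_prog r m = Seq (Act (\<lambda>_. layout_action Stay (Some 0) (\<lambda>_. (None, Stay)) (\<lambda>_. Stay)))
     (Seq (Seq (rewind_prog (r + m)) (sweep_prog r (r + m))) reset_oracle)"

definition call_prog :: "otm \<Rightarrow> (bool option \<Rightarrow> bool option) \<Rightarrow> nat \<Rightarrow> nat \<Rightarrow> tape prog" where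
  "call_prog M \<phi> r m = Seq (start_prog r m) (Seq (sim_prog M \<phi> (r + m)) (finish_prog r m))"

lemma run_reset_oracle: "run N x reset_oracle (h, layout q W env) (0, layout q W env)"
proof -
  have move: "run N x (oracle_prog m) (h, layout q W env) (move_head m h, layout q W env)" for m h
    unfolding oracle_prog_def
    by (intro exec_ActI act_layoutI) (simp_all add: act_tape_keep written_def)
  have "run N x (While (\<lambda>s. fst s = None) (oracle_prog Move_Right))
      ((\<lambda>i. (h + int i, layout q W env)) 0) ((\<lambda>i. (h + int i, layout q W env)) (nat (- h)))"
  proof (rule exec_loop)
    show "run N x (oracle_prog Move_Right)
        (h + int i, layout q W env) (h + int (Suc i), layout q W env)" for i
      using move[of Move_Right "h + int i"] by (simp add: algebra_simps)
  qed (auto simp: observed_def oracle_cell_def)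
  moreover define h' where "h' = h + int (nat (- h))"
  moreover have "run N x (While (\<lambda>s. fst s \<noteq> None) (oracle_prog Move_Left))
      ((\<lambda>i. (h' - int i, layout q W env)) 0) ((\<lambda>i. (h' - int i, layout q W env)) (Suc (nat h')))"
  proof (rule exec_loop)
    show "run N x (oracle_prog Move_Left)
        (h' - int i, layout q W env) (h' - int (Suc i), layout q W env)" for i
      using move[of Move_Left "h' - int i"] by (simp add: algebra_simps)
  qed (auto simp: observed_def oracle_cell_def h'_def)
  moreover have "h' - int (Suc (nat h')) = -1" by (simp add: h'_def)
  ultimately show ?thesis
    unfolding reset_oracle_def using move[of Move_Right "-1"] by (auto intro: exec_Seq)
qed

lemma tape_bounded_input_tape: "tape_bounded 2 (length (encoded as)) (input_tape as)"
proof -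
  have "l ! m \<le> 1" if "m < length l" "l = encoded as" for l m
    using nth_mem[OF that(1)] by (auto simp: that(2) encoded_def split: if_splits)
  then show ?thesis
    by (force simp: tape_bounded_def input_tape_def encoded_def Let_def less_Suc_eq_le)
qed

lemma tape_bounded_mono: "tape_bounded s B w \<Longrightarrow> s \<le> s' \<Longrightarrow> tape_bounded s' B w"
  unfolding tape_bounded_def using less_le_trans by blast

lemma run_start:
  assumes N: "Suc (length (vs @ as)) < N"
  shows "run N x (start_prog (length vs) (length as)) (0, store (vs @ as))
    (0, io_layout (input_tape as)
      (vs @ replicate (length as) 0 @ [length (encoded as), Suc (length (encoded as))]))"
proof -
  let ?t = "length vs + length as" and ?zs = "vs @ replicate (length as) 0"
  let ?B = "length (encoded as)"
  have "(stack (vs @ as))(Suc ?t := Suc (stack (vs @ as) (Suc ?t))) = stack (vs @ as @ [0, Suc 0])"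
    by (auto simp: stack_def fun_eq_iff nth_append less_Suc_eq)
  then have inc: "run N x (inc_prog (Suc ?t)) (0, store (vs @ as)) (0, arg_layout [] (vs @ as) 0)"
    using run_inc[of "Suc ?t" N x 0 0 "\<lambda>_. blank" "stack (vs @ as)"] N
    by (simp add: fun_upd_idem[where f = "\<lambda>_. blank"])
  have args: "run N x (write_args ?t (length vs) (length as)) (0, arg_layout [] (vs @ as) 0)
      (0, arg_layout (encoded as) ?zs ?B)"
    using run_write_args[of ?t N vs as 0 x 0 "[]" 0] N by simp
  have "act_tape N (None, Move_Right) (pushed (encoded as)) = input_tape as"
    by (auto simp: act_tape_right pushed_def input_tape_def encoded_def Let_def fun_eq_iff)
  then have "run N x (Act (\<lambda>_. io_action (None, Move_Right) (\<lambda>_. Stay)))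
      (0, arg_layout (encoded as) ?zs ?B) (0, io_layout (input_tape as) (?zs @ [?B, Suc ?B]))"
    using N by (intro exec_ActI act_io_action) auto
  then show ?thesis
    using exec_Seq[OF inc exec_Seq[OF args]] unfolding start_prog_def append_assoc by blast
qed

lemma run_finish:
  assumes N: "Suc (length vs + m) < N" and c: "config_bounded M B (q, h, ws)"
    and M: "1 \<le> num_tapes M" "num_tapes M \<le> N"
  shows "run N x (finish_prog (length vs) m)
    (h, layout q (work ws) (stack (vs @ replicate m 0 @ [B, Suc B])))
    (0, store (vs @ [otm_output (q, h, ws)]))"
proof -
  let ?t = "length vs + m" and ?zs = "vs @ replicate m 0"
  have clear: "run N x (Act (\<lambda>_. layout_action Stay (Some 0) (\<lambda>_. (None, Stay)) (\<lambda>_. Stay)))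
      (h, layout q (work ws) env) (h, layout 0 (work ws) env)" for env
    using N by (intro exec_ActI act_layoutI) (simp_all add: act_tape_keep written_def)
  have "card {j. work ws 0 j = 1} = otm_output (q, h, ws)"
    using c M card_head_view[of "hd ws" 1] by (cases ws) (auto simp: work_def)
  then have "(stack ?zs)(length vs := card {j. work ws 0 j = 1}) =
      stack (vs @ [otm_output (q, h, ws)])"
    unfolding stack_append_zeros by (auto simp: stack_def nth_append fun_eq_iff less_Suc_eq)
  moreover have "stack ?zs (length vs) = 0" unfolding stack_append_zeros by (simp add: stack_def)
  moreover have "work ws j = blank" if "N \<le> j" for j using that c M by (simp add: work_def)
  ultimately have erase: "run N x (Seq (rewind_prog ?t) (sweep_prog (length vs) ?t))
      (h, layout 0 (work ws) (stack (?zs @ [B, Suc B]))) (h, store (vs @ [otm_output (q, h, ws)]))"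
    using run_erase[of ?zs N "length vs" "work ws" "num_symbols M" B x h 0] c N by simp
  from exec_Seq[OF clear exec_Seq[OF erase run_reset_oracle]] show ?thesis
    unfolding finish_prog_def by simp
qed

lemma (in simulation) run_call:
  assumes yields: "otm_yields M y as out" and N: "Suc (length (vs @ as)) < N"
  shows "run N x (call_prog M \<phi> (length vs) (length as))
    (0, store (vs @ as)) (0, store (vs @ [out]))"
proof -
  let ?t = "length vs + length as" and ?zs = "vs @ replicate (length as) 0"
  let ?B = "length (encoded as)" and ?timers = "\<lambda>B. vs @ replicate (length as) 0 @ [B, Suc B]"
  let ?ws = "(0, input_tape as) # replicate (num_tapes M - 1) (0, \<lambda>_. 0)"
  have pos: "1 \<le> num_states M" "2 \<le> num_symbols M" "1 \<le> num_tapes M"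
    using M(1) by (auto simp: valid_otm_def)
  obtain q h ws where steps: "(\<lambda>c c'. otm_step M y c = Some c')\<^sup>*\<^sup>* (0, 0, ?ws) (q, h, ws)"
    and halt: "otm_step M y (q, h, ws) = None" and out: "otm_output (q, h, ws) = out"
    using yields by (auto simp: otm_yields_def otm_init_def)
  have work: "work ?ws = (\<lambda>_. blank)(0 := input_tape as)"
    using pos by (auto simp: work_def head_view_def blank_def fun_eq_iff nth_Cons')
  have "tape_bounded (num_symbols M) ?B (work ?ws j)" for j
    unfolding work using pos tape_bounded_mono[OF tape_bounded_input_tape]
    by (simp add: tape_bounded_def blank_def)
  then have "config_bounded M ?B (0, 0, ?ws)" using pos by simp
  moreover have t: "length ?zs = ?t" by simp
  moreover have "Suc (length ?zs) < N" using N by simp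
  ultimately obtain B where bounded: "config_bounded M B (q, h, ws)"
    and sim: "run N x (sim_prog M \<phi> ?t) (0, io_layout (input_tape as) (?timers ?B))
      (h, layout q (work ws) (stack (?timers B)))"
    using run_sim_prog[of ?zs ?B 0 0 ?ws, OF _ _ steps halt] unfolding work t append_assoc by metis
  have "run N x (finish_prog (length vs) (length as))
      (h, layout q (work ws) (stack (?timers B))) (0, store (vs @ [out]))"
    using run_finish[OF _ bounded pos(3) M(4), of vs "length as" x] N out by simp
  then show ?thesis
    unfolding call_prog_def using exec_Seq[OF run_start[OF N] exec_Seq[OF sim]] by blast
qed

section \<open>Functions computed by programs\<close>

text \<open>Variables may be placed in arbitrary registers below the stack position where the value is to
  be pushed. Binders put their variable at index \<open>0\<close> and shift the others.\<close>

definition program_computable :: "((nat \<Rightarrow> bool) \<Rightarrow> (nat \<Rightarrow> nat) \<Rightarrow> nat) \<Rightarrow> bool" where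
  "program_computable f \<longleftrightarrow> (\<forall>\<rho> n. (\<forall>k. \<rho> k < n) \<longrightarrow>
     (\<exists>p. stack_op n p (\<lambda>x vs. vs @ [f x (\<lambda>k. vs ! \<rho> k)])))"

definition program_decidable :: "((nat \<Rightarrow> bool) \<Rightarrow> (nat \<Rightarrow> nat) \<Rightarrow> bool) \<Rightarrow> bool" where
  "program_decidable P \<longleftrightarrow> program_computable (\<lambda>x v. of_bool (P x v))"

lemma program_computableD:
  "program_computable f \<Longrightarrow> \<forall>k. \<rho> k < n \<Longrightarrow>
    \<exists>p. stack_op n p (\<lambda>x vs. vs @ [f x (\<lambda>k. vs ! \<rho> k)])"
  by (simp add: program_computable_def)

subsection \<open>Primitive recursion\<close>

lemma program_computable_var: "program_computable (\<lambda>x v. v k)"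
  unfolding program_computable_def by (blast intro: stack_op_push_copy)

lemma program_computable_rename:
  "program_computable f \<Longrightarrow> program_computable (\<lambda>x v. f x (\<lambda>k. v (\<sigma> k)))"
  unfolding program_computable_def by (auto dest: spec[where x = "\<lambda>k. _ (\<sigma> k)"])

lemma program_computable_0: "program_computable (\<lambda>x v. 0)"
  unfolding program_computable_def
  by (intro allI impI exI, rule stack_op_cong[OF stack_op_skip]) simp

lemma program_computable_Suc:
  assumes "program_computable f"
  shows "program_computable (\<lambda>x v. Suc (f x v))"
  unfolding program_computable_def
proof (intro allI impI)
  fix \<rho> :: "nat \<Rightarrow> nat" and n assume "\<forall>k. \<rho> k < n"
  then obtain p where p: "stack_op n p (\<lambda>x vs. vs @ [f x (\<lambda>k. vs ! \<rho> k)])"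
    using program_computableD[OF assms] by blast
  have "stack_op n (Seq p (inc_prog n))
      (\<lambda>x vs. (vs @ [f x (\<lambda>k. vs ! \<rho> k)])[n := Suc ((vs @ [f x (\<lambda>k. vs ! \<rho> k)]) ! n)])"
    by (rule stack_op_Seq[OF p stack_op_inc]) auto
  then have "stack_op n (Seq p (inc_prog n)) (\<lambda>x vs. vs @ [Suc (f x (\<lambda>k. vs ! \<rho> k))])"
    by (rule stack_op_cong) auto
  then show "\<exists>p. stack_op n p (\<lambda>x vs. vs @ [Suc (f x (\<lambda>k. vs ! \<rho> k))])" ..
qed

lemma drained_clear: "drained r {} vs = vs[r := 0]"
  by (rule nth_equalityI) (auto simp: drained_def nth_list_update)

lemma drained_move: "r \<noteq> s \<Longrightarrow> drained r {s} vs = vs[s := vs ! s + vs ! r, r := 0]"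
  by (rule nth_equalityI) (auto simp: drained_def nth_list_update)

lemma transferred_decrement: "transferred r {} (Suc 0) vs = vs[r := vs ! r - 1]"
  by (rule nth_equalityI) (auto simp: transferred_def nth_list_update)

text \<open>The stack holds the accumulator, the index and the number of remaining iterations.\<close>

lemma primrec_update:
  fixes vs :: "nat list" and b :: nat
  assumes "length vs = n + 3"
  defines "ws \<equiv> drained (n + 3) {n} (drained n {} (vs @ [b]))"
  shows "transferred (n + 2) {} 1 (ws[n + 1 := Suc (ws ! (n + 1))]) =
    take n vs @ [b, Suc (vs ! (n + 1)), vs ! (n + 2) - 1, 0]"
proof -
  have "length (drop n vs) = 3" using assms by simp
  then obtain a i c where drop: "drop n vs = [a, i, c]"
    by (auto simp: numeral_3_eq_3 length_Suc_conv simp del: length_drop)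
  define us where "us = take n vs"
  have vs: "vs = us @ [a, i, c]" unfolding us_def drop[symmetric] by simp
  have "length us = n" using assms by (simp add: us_def)
  then show ?thesis
    by (simp add: ws_def vs drained_clear drained_move transferred_decrement list_update_append
        nth_append eval_nat_numeral)
qed

lemma stack_op_primrec_step:
  assumes h: "program_computable (\<lambda>x v. h x (\<lambda>k. v (Suc (Suc k))) (v 0) (v (Suc 0)))"
    and \<rho>: "\<forall>k. \<rho> k < n"
  obtains p where "stack_op (n + 3) p (\<lambda>x vs. take n vs @
    [h x (\<lambda>k. vs ! \<rho> k) (vs ! (n + 1)) (vs ! n), Suc (vs ! (n + 1)), vs ! (n + 2) - 1])"
proof -
  let ?h = "\<lambda>x vs. h x (\<lambda>k. vs ! \<rho> k) (vs ! (n + 1)) (vs ! n)"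
  let ?step = "\<lambda>x vs. take n vs @ [?h x vs, Suc (vs ! (n + 1)), vs ! (n + 2) - 1]"
  define \<rho>' where "\<rho>' = case_nat (n + 1) (case_nat n \<rho>)"
  have "\<forall>k. \<rho>' k < n + 3"
    unfolding \<rho>'_def using \<rho> by (auto split: nat.split intro: trans_less_add1)
  then obtain q where "stack_op (n + 3) q
      (\<lambda>x vs. vs @ [h x (\<lambda>k. vs ! \<rho>' (Suc (Suc k))) (vs ! \<rho>' 0) (vs ! \<rho>' (Suc 0))])"
    using program_computableD[OF h] by blast
  then have q: "stack_op (n + 3) q (\<lambda>x vs. vs @ [?h x vs])" by (simp add: \<rho>'_def)
  let ?p = "Seq q (Seq (drain_prog n {}) (Seq (drain_prog (n + 3) {n})
    (Seq (inc_prog (n + 1)) (transfer_prog (n + 2) {}))))"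
  let ?inc = "\<lambda>ws. ws[n + 1 := Suc (ws ! (n + 1))]"
  have "stack_op (n + 3) ?p (\<lambda>x vs. transferred (n + 2) {} 1
      (?inc (drained (n + 3) {n} (drained n {} (vs @ [?h x vs])))))"
    by (rule stack_op_Seq[OF q stack_op_Seq[OF stack_op_drain[of n "n + 4" "{}"]
        stack_op_Seq[OF stack_op_drain[of "n + 3" "n + 4" "{n}"]
          stack_op_Seq[OF stack_op_inc[of "n + 1" "n + 4"]
            stack_op_transfer[of "n + 2" "n + 4" "{}"]]]]])
      (auto simp: drained_def)
  then have "stack_op (n + 3) ?p ?step"
  proof (rule stack_op_cong)
    fix x and vs :: "nat list" assume "length vs = n + 3"
    then have "transferred (n + 2) {} 1
        (?inc (drained (n + 3) {n} (drained n {} (vs @ [?h x vs])))) = ?step x vs @ [0]"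
      by (simp only: primrec_update append_assoc append_Cons append_Nil)
    then show "stack (transferred (n + 2) {} 1
        (?inc (drained (n + 3) {n} (drained n {} (vs @ [?h x vs]))))) = stack (?step x vs)"
      by (simp only: stack_append_zero)
  qed
  then show thesis by (rule that)
qed

lemma stack_op_primrec_loop:
  assumes h: "program_computable (\<lambda>x v. h x (\<lambda>k. v (Suc (Suc k))) (v 0) (v (Suc 0)))"
    and \<rho>: "\<forall>k. \<rho> k < n"
  obtains p G where "stack_op (n + 3) p G"
    "\<And>x vs. length vs = n + 3 \<Longrightarrow> length (G x vs) = n + 3"
    "\<And>x vs a c. length vs = n \<Longrightarrow>
      G x (vs @ [a, 0, c]) = vs @ [rec_nat a (h x (\<lambda>k. vs ! \<rho> k)) c, c, 0]"
proof -
  define F where "F x vs = take n vs @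
    [h x (\<lambda>k. vs ! \<rho> k) (vs ! (n + 1)) (vs ! n), Suc (vs ! (n + 1)), vs ! (n + 2) - 1]" for x vs
  obtain p where "stack_op (n + 3) p F"
    unfolding F_def by (rule stack_op_primrec_step[OF h \<rho>])
  then have loop: "stack_op (n + 3) (While (nonzero (n + 2)) p) (\<lambda>x vs. (F x ^^ (vs ! (n + 2))) vs)"
    by (rule stack_op_while) (auto simp: F_def nth_append)
  have len: "length ((F x ^^ k) vs) = n + 3" if "length vs = n + 3" for x k vs
    using that by (induction k) (auto simp: F_def)
  have "(F x ^^ k) (vs @ [a, 0, c]) = vs @ [rec_nat a (h x (\<lambda>k. vs ! \<rho> k)) k, k, c - k]"
    if "length vs = n" for x vs a c k
  proof (induction k)
    case (Suc k)
    then show ?case using that \<rho> by (simp add: F_def nth_append)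
  qed simp
  then have "(F x ^^ ((vs @ [a, 0, c]) ! (n + 2))) (vs @ [a, 0, c]) =
      vs @ [rec_nat a (h x (\<lambda>k. vs ! \<rho> k)) c, c, 0]" if "length vs = n" for x vs a c
    using that by (simp add: nth_append)
  with loop len show thesis by (rule that)
qed

lemma program_computable_primrec:
  assumes f: "program_computable f" and g: "program_computable g"
    and h: "program_computable (\<lambda>x v. h x (\<lambda>k. v (Suc (Suc k))) (v 0) (v (Suc 0)))"
  shows "program_computable (\<lambda>x v. rec_nat (f x v) (h x v) (g x v))"
  unfolding program_computable_def
proof (intro allI impI)
  fix \<rho> :: "nat \<Rightarrow> nat" and n assume \<rho>: "\<forall>k. \<rho> k < n"
  let ?v = "\<lambda>vs k. vs ! \<rho> k"
  let ?rec = "\<lambda>x vs. rec_nat (f x (?v vs)) (h x (?v vs)) (g x (?v vs))"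
  obtain p where p: "stack_op n p (\<lambda>x vs. vs @ [f x (?v vs)])"
    using program_computableD[OF f \<rho>] by blast
  have "\<forall>k. \<rho> k < n + 2" using \<rho> trans_less_add1 by blast
  then obtain q where "stack_op (n + 2) q (\<lambda>x vs. vs @ [g x (?v vs)])"
    using program_computableD[OF g] by blast
  then have "stack_op ((n + 1) + 1) q (\<lambda>x vs. vs @ [g x (?v vs)])" by simp
  from stack_op_push_zeros[OF this]
  have q: "stack_op (n + 1) q (\<lambda>x vs. vs @ [0, g x (?v (vs @ [0]))])" by simp
  obtain w G where w: "stack_op (n + 3) w G"
    and len: "\<And>x vs. length vs = n + 3 \<Longrightarrow> length (G x vs) = n + 3"
    and G: "\<And>x vs a c. length vs = n \<Longrightarrow>
      G x (vs @ [a, 0, c]) = vs @ [rec_nat a (h x (?v vs)) c, c, 0]"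
    by (rule stack_op_primrec_loop[OF h \<rho>]) (rule that)
  let ?p = "Seq p (Seq q (Seq w (drain_prog (n + 1) {})))"
  let ?pushed = "\<lambda>x vs. vs @ [f x (?v vs)]"
  have "stack_op n ?p (\<lambda>x vs.
      drained (n + 1) {} (G x (?pushed x vs @ [0, g x (?v (?pushed x vs @ [0]))])))"
    by (rule stack_op_Seq[OF p stack_op_Seq[OF q stack_op_Seq[OF w
        stack_op_drain[of "n + 1" "n + 3" "{}"]]]]) (auto simp: len)
  then have "stack_op n ?p (\<lambda>x vs. vs @ [?rec x vs])"
  proof (rule stack_op_cong)
    fix x and vs :: "nat list" assume "length vs = n"
    then show "stack (drained (n + 1) {}
        (G x (?pushed x vs @ [0, g x (?v (?pushed x vs @ [0]))]))) = stack (vs @ [?rec x vs])"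
      using \<rho> stack_append_zeros[of "vs @ [?rec x vs]" 2]
      by (simp add: G nth_append drained_clear list_update_append numeral_2_eq_2)
  qed
  then show "\<exists>p. stack_op n p (\<lambda>x vs. vs @ [?rec x vs])" ..
qed

subsection \<open>Machine calls\<close>

lemma stack_op_push_list:
  assumes "\<forall>f\<in>set fs. program_computable f" "\<forall>k. \<rho> k < n"
  shows "\<exists>p. stack_op n p (\<lambda>x vs. vs @ map (\<lambda>f. f x (\<lambda>k. vs ! \<rho> k)) fs)"
  using assms(1)
proof (induction fs rule: rev_induct)
  case Nil
  show ?case using stack_op_skip by auto
next
  case (snoc f fs)
  let ?fs = "\<lambda>x vs. map (\<lambda>f. f x (\<lambda>k. vs ! \<rho> k)) fs"
  obtain p where p: "stack_op n p (\<lambda>x vs. vs @ ?fs x vs)" using snoc by auto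
  have "\<forall>k. \<rho> k < n + length fs" using assms(2) trans_less_add1 by blast
  then obtain q where "stack_op (n + length fs) q (\<lambda>x vs. vs @ [f x (\<lambda>k. vs ! \<rho> k)])"
    using program_computableD[of f \<rho> "n + length fs"] snoc.prems by auto
  from stack_op_Seq[OF p this]
  have "stack_op n (Seq p q) (\<lambda>x vs. (vs @ ?fs x vs) @ [f x (\<lambda>k. (vs @ ?fs x vs) ! \<rho> k)])" by simp
  then have "stack_op n (Seq p q) (\<lambda>x vs. vs @ map (\<lambda>f. f x (\<lambda>k. vs ! \<rho> k)) (fs @ [f]))"
    by (rule stack_op_cong) (use assms(2) in \<open>simp add: nth_append\<close>)
  then show ?case ..
qed

lemma stack_op_call:
  assumes "valid_otm M" "\<And>x h. oracle_cell (Y x) h = \<phi> (oracle_cell x h)"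
    and "\<And>x as. length as = m \<Longrightarrow> otm_yields M (Y x) as (F x as)"
  shows "stack_op (n + m) (call_prog M \<phi> n m) (\<lambda>x vs. take n vs @ [F x (drop n vs)])"
  unfolding stack_op_def
  using eventually_gt_at_top[of "Suc (n + m)"] eventually_ge_at_top[of "num_states M"]
    eventually_ge_at_top[of "num_symbols M"] eventually_ge_at_top[of "num_tapes M"]
proof eventually_elim
  case (elim N)
  show ?case
  proof (intro allI impI)
    fix x and vs :: "nat list" assume vs: "length vs = n + m"
    interpret simulation N M \<phi> x "Y x"
      using assms(1,2) elim by unfold_locales
    show "run N x (call_prog M \<phi> n m) (0, store vs) (0, store (take n vs @ [F x (drop n vs)]))"
      using run_call[of "drop n vs" "F x (drop n vs)" "take n vs"] assms(3)[of "drop n vs" x]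
        elim(1) vs by simp
  qed
qed

lemma program_computable_call:
  assumes "valid_otm M" "\<And>x h. oracle_cell (Y x) h = \<phi> (oracle_cell x h)"
    and "\<And>x as. length as = length fs \<Longrightarrow> otm_yields M (Y x) as (F x as)"
    and fs: "\<forall>f\<in>set fs. program_computable f"
  shows "program_computable (\<lambda>x v. F x (map (\<lambda>f. f x v) fs))"
  unfolding program_computable_def
proof (intro allI impI)
  fix \<rho> :: "nat \<Rightarrow> nat" and n assume "\<forall>k. \<rho> k < n"
  with fs obtain p where p: "stack_op n p (\<lambda>x vs. vs @ map (\<lambda>f. f x (\<lambda>k. vs ! \<rho> k)) fs)"
    using stack_op_push_list by blast
  have "stack_op (n + length fs) (call_prog M \<phi> n (length fs))
      (\<lambda>x vs. take n vs @ [F x (drop n vs)])"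
    using assms(1-3) by (rule stack_op_call)
  from stack_op_Seq[OF p this]
  have "stack_op n (Seq p (call_prog M \<phi> n (length fs)))
      (\<lambda>x vs. vs @ [F x (map (\<lambda>f. f x (\<lambda>k. vs ! \<rho> k)) fs)])"
    by (auto elim: stack_op_cong)
  then show "\<exists>p. stack_op n p (\<lambda>x vs. vs @ [F x (map (\<lambda>f. f x (\<lambda>k. vs ! \<rho> k)) fs)])" ..
qed

lemma program_computable_computable_fun:
  assumes "computable_fun g" "program_computable f"
  shows "program_computable (\<lambda>x v. g (f x v))"
proof -
  obtain M where M: "valid_otm M" "\<And>n. otm_yields M (\<lambda>_. False) [n] (g n)"
    using assms(1) unfolding computable_fun_def by blast
  have "oracle_cell (\<lambda>_. False) h = map_option (\<lambda>_. False) (oracle_cell x h)" for x h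
    by (simp add: oracle_cell_def)
  moreover have "otm_yields M (\<lambda>_. False) as (g (hd as))" if "length as = length [f]" for as
    using that M(2) by (cases as) auto
  ultimately show ?thesis
    using program_computable_call[OF M(1), of "\<lambda>_ _. False" "map_option (\<lambda>_. False)" "[f]"
        "\<lambda>_ as. g (hd as)"] assms(2) by simp
qed

lemma program_decidable_computable_rel:
  assumes "computable_rel (length fs) R" "\<forall>f\<in>set fs. program_computable f"
  shows "program_decidable (\<lambda>x v. R x (map (\<lambda>f. f x v) fs))"
proof -
  obtain M where "valid_otm M" "\<And>x as. length as = length fs \<Longrightarrow> otm_yields M x as (of_bool (R x as))"
    using assms(1) unfolding computable_rel_def by blast
  from program_computable_call[OF this(1) _ this(2) assms(2), where \<phi> = id]
  show ?thesis by (simp add: program_decidable_def)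
qed

subsection \<open>Input and output\<close>

definition strokes :: "int \<Rightarrow> int \<Rightarrow> int \<Rightarrow> nat" where
  "strokes a b = (\<lambda>j. if a \<le> j \<and> j < b then 1 else 0)"

definition init_prog :: "tape prog" where
  "init_prog = Act (\<lambda>_. (Stay, \<lambda>t. (case t of Reg r \<Rightarrow> Some 2 | _ \<Rightarrow> None, Stay)))"

definition read_prog :: "tape prog" where
  "read_prog = While (\<lambda>s. snd s (Work 0) = 1) (Act (\<lambda>_. io_action (Some 0, Move_Right)
     (\<lambda>i. if i = 0 then Move_Right else Stay)))"

definition print_prog :: "tape prog" where
  "print_prog = While (nonzero 1) (Act (\<lambda>_. io_action (Some 1, Move_Right)
     (\<lambda>i. if i = 1 then Move_Left else Stay)))"

lemma run_init:
  assumes "2 < N"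
  shows "run N x init_prog
    (0, \<lambda>t. case t of Reg r \<Rightarrow> if r < N then blank else counter 0 | Work 0 \<Rightarrow> w | _ \<Rightarrow> blank)
    (0, io_layout w [])"
proof -
  have "act_tape N (Some 2, Stay) blank = counter 0"
    using assms by (auto simp: act_tape_def written_def blank_def counter_def fun_eq_iff)
  then show ?thesis
    unfolding init_prog_def
    by (intro exec_ActI) (auto simp: act_def act_tape_keep layout_def stack_def fun_eq_iff
      split: tape.split nat.split)
qed

lemma run_read:
  assumes "2 < N"
  shows "run N x read_prog (0, io_layout (strokes 0 (int m)) []) (0, store [m])"
proof -
  define \<sigma> where "\<sigma> i = (0 :: int, io_layout (strokes 0 (int m - int i)) [i])" for i
  have "run N x read_prog (\<sigma> 0) (\<sigma> m)"
    unfolding read_prog_def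
  proof (rule exec_loop)
    have scanned: "snd (observed (set (tapes N)) x (\<sigma> i)) (Work 0) = of_bool (i < m)" for i
      using assms by (simp add: \<sigma>_def observed_def strokes_def)
    show "snd (observed (set (tapes N)) x (\<sigma> i)) (Work 0) = 1" if "i < m" for i
      using that by (simp add: scanned)
    show "snd (observed (set (tapes N)) x (\<sigma> m)) (Work 0) \<noteq> 1" by (simp add: scanned)
    fix i
    have "act_tape N (Some 0, Move_Right) (strokes 0 (int m - int i)) =
        strokes 0 (int m - int (Suc i))"
      using assms by (auto simp: act_tape_def written_def strokes_def fun_eq_iff)
    then show "run N x (Act (\<lambda>_. io_action (Some 0, Move_Right)
        (\<lambda>i. if i = 0 then Move_Right else Stay))) (\<sigma> i) (\<sigma> (Suc i))"
      unfolding \<sigma>_def using assms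
      by (intro exec_ActI act_io_action) (auto simp: stack_def split: if_splits)
  qed
  moreover have "strokes 0 0 = blank" by (auto simp: strokes_def blank_def)
  ultimately show ?thesis using stack_append_zero[of "[]"] by (simp add: \<sigma>_def fun_upd_idem)
qed

lemma run_print:
  assumes "2 < N"
  shows "run N x print_prog (0, store [m, v]) (0, io_layout (strokes (- int v) 0) [m])"
proof -
  define \<sigma> where "\<sigma> i = (0 :: int, io_layout (strokes (- int i) 0) [m, v - i])" for i
  have "run N x print_prog (\<sigma> 0) (\<sigma> v)"
    unfolding print_prog_def
  proof (rule exec_loop)
    show "nonzero 1 (observed (set (tapes N)) x (\<sigma> i))" if "i < v" for i
      using that assms by (simp add: \<sigma>_def nonzero_iff stack_def)
    show "\<not> nonzero 1 (observed (set (tapes N)) x (\<sigma> v))"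
      using assms by (simp add: \<sigma>_def nonzero_iff stack_def)
    fix i assume i: "i < v"
    have "act_tape N (Some 1, Move_Right) (strokes (- int i) 0) = strokes (- int (Suc i)) 0"
      using assms by (auto simp: act_tape_def written_def strokes_def fun_eq_iff)
    then show "run N x (Act (\<lambda>_. io_action (Some 1, Move_Right)
        (\<lambda>i. if i = 1 then Move_Left else Stay))) (\<sigma> i) (\<sigma> (Suc i))"
      unfolding \<sigma>_def using assms i
      by (intro exec_ActI act_io_action) (auto simp: stack_def nth_Cons' split: if_splits)
  qed
  moreover have "strokes 0 0 = blank" by (auto simp: strokes_def blank_def)
  ultimately show ?thesis using stack_append_zero[of "[m]"] by (simp add: \<sigma>_def fun_upd_idem)
qed

text \<open>The number of strokes of the input is one more than the argument.\<close>

definition main_prog :: "tape prog \<Rightarrow> tape prog" where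
  "main_prog p = Seq init_prog (Seq read_prog (Seq (transfer_prog 0 {}) (Seq p print_prog)))"

lemma otm_yields_main_prog:
  assumes N: "2 < N" and p: "run N x p (0, store [m]) (0, store [m, v])"
  shows "otm_yields (compiled (tapes N) N (main_prog p)) x [m] v"
proof -
  let ?T = "\<lambda>t. case t of Reg r \<Rightarrow> if r < N then blank else counter 0 | Work 0 \<Rightarrow> input_tape [m]
    | _ \<Rightarrow> blank"
  have input: "input_tape [m] = strokes 0 (int (Suc m))"
    by (auto simp: input_tape_def strokes_def Let_def fun_eq_iff nth_append simp del: replicate_Suc)
  have init: "run N x init_prog (0, ?T) (0, io_layout (strokes 0 (int (Suc m))) [])"
    unfolding input by (rule run_init[OF N])
  have "(\<lambda>i. if i = 0 then stack [Suc m] i - 1 else if i \<in> {} \<and> stack [Suc m] 0 \<noteq> 0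
      then Suc (stack [Suc m] i) else stack [Suc m] i) = stack [m]"
    by (auto simp: stack_def)
  then have dec: "run N x (transfer_prog 0 {}) (0, store [Suc m]) (0, store [m])"
    using run_transfer[of 0 N "{}" x 0 0 "\<lambda>_. blank" "stack [Suc m]"] N by (simp only:) simp
  have main: "run N x (main_prog p) (0, ?T) (0, io_layout (strokes (- int v) 0) [m])"
    unfolding main_prog_def
    by (rule exec_Seq[OF init exec_Seq[OF run_read[OF N] exec_Seq[OF dec
        exec_Seq[OF p run_print[OF N]]]]])
  define ts where "ts = map Work [1..<N] @ State # map Reg [0..<N]"
  have ts: "tapes N = Work 0 # ts" using N by (simp add: tapes_def ts_def upt_conv_Cons)
  have blanks: "?T t = (\<lambda>_. 0)" if "t \<in> set ts" for t
    using that by (auto simp: ts_def blank_def split: nat.split)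
  have "otm_yields (compiled (Work 0 # ts) N (main_prog p)) x [m]
      (card {j. io_layout (strokes (- int v) 0) [m] (Work 0) j = 1})"
    by (rule compiled_yields[OF main[unfolded ts] _ blanks]) simp_all
  moreover have "{j. strokes (- int v) 0 j = 1} = {- int v..<0}" by (auto simp: strokes_def)
  ultimately show ?thesis by (simp add: ts)
qed

lemma program_computable_machine:
  assumes "program_computable f"
  obtains M where "valid_otm M" "\<And>x n. otm_yields M x [n] (f x (\<lambda>_. n))"
proof -
  obtain p where "stack_op 1 p (\<lambda>x vs. vs @ [f x (\<lambda>_. vs ! 0)])"
    using program_computableD[OF assms, of "\<lambda>_. 0" 1] by auto
  then have "\<forall>\<^sub>F N in sequentially. 2 < N \<and>
      (\<forall>x n. run N x p (0, store [n]) (0, store [n, f x (\<lambda>_. n)]))"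
    unfolding stack_op_def using eventually_gt_at_top[of 2]
  proof eventually_elim
    case (elim N)
    have "run N x p (0, store [n]) (0, store [n, f x (\<lambda>_. n)])" for x n
      using elim(1)[rule_format, of "[n]" x] by simp
    then show ?case using elim(2) by simp
  qed
  then obtain N where N: "2 < N" "\<And>x n. run N x p (0, store [n]) (0, store [n, f x (\<lambda>_. n)])"
    by (auto dest: eventually_happens)
  show thesis
  proof
    show "valid_otm (compiled (tapes N) N (main_prog p))"
      using N(1) by (intro valid_compiled) (auto simp: tapes_def)
    show "otm_yields (compiled (tapes N) N (main_prog p)) x [n] (f x (\<lambda>_. n))" for x n
      using N by (rule otm_yields_main_prog)
  qed
qed

lemma computable_functional_program_decidable:
  "program_decidable P \<Longrightarrow> computable_functional (\<lambda>x n. P x (\<lambda>_. n))"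
  unfolding program_decidable_def computable_functional_def
  by (metis program_computable_machine)

subsection \<open>Arithmetic and bounded quantification\<close>

lemma program_computable_const: "program_computable (\<lambda>x v. c)"
  by (induction c) (intro program_computable_0 program_computable_Suc)+

lemma program_computable_add:
  assumes "program_computable f" "program_computable g"
  shows "program_computable (\<lambda>x v. f x v + g x v)"
proof -
  have "rec_nat a (\<lambda>_. Suc) n = a + n" for a n :: nat by (induction n) auto
  then show ?thesis
    using program_computable_primrec[OF assms, of "\<lambda>_ _ _. Suc"]
    by (simp add: program_computable_Suc program_computable_var)
qed

lemma program_computable_pred:
  assumes "program_computable f"
  shows "program_computable (\<lambda>x v. f x v - 1)"
proof -
  have "rec_nat 0 (\<lambda>i _. i) n = n - 1" for n :: nat by (cases n) auto
  then show ?thesis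
    using program_computable_primrec[OF program_computable_0 assms, of "\<lambda>_ _ i _. i"]
    by (simp add: program_computable_var)
qed

lemma program_computable_diff:
  assumes "program_computable f" "program_computable g"
  shows "program_computable (\<lambda>x v. f x v - g x v)"
proof -
  have "rec_nat a (\<lambda>_ b. b - 1) n = a - n" for a n :: nat by (induction n) auto
  then show ?thesis
    using program_computable_primrec[OF assms, of "\<lambda>_ _ _ b. b - 1"]
      program_computable_pred[OF program_computable_var] by simp
qed

lemma program_computable_sum:
  assumes f: "program_computable (\<lambda>x v. f x (\<lambda>k. v (Suc k)) (v 0))" and g: "program_computable g"
  shows "program_computable (\<lambda>x v. \<Sum>i<g x v. f x v i)"
proof -
  have "rec_nat 0 (\<lambda>i b. b + h i) n = (\<Sum>i<n. h i)" for h :: "nat \<Rightarrow> nat" and n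
    by (induction n) auto
  moreover have "program_computable (\<lambda>x v. v (Suc 0) + f x (\<lambda>k. v (Suc (Suc k))) (v 0))"
    using program_computable_rename[OF f, of "case_nat 0 (\<lambda>k. Suc (Suc k))"]
    by (intro program_computable_add program_computable_var) simp
  ultimately show ?thesis
    using program_computable_primrec[OF program_computable_0 g, of "\<lambda>x v i b. b + f x v i"] by simp
qed

lemma program_computable_mult:
  assumes "program_computable f" "program_computable g"
  shows "program_computable (\<lambda>x v. f x v * g x v)"
  using program_computable_sum[of "\<lambda>x v _. f x v",
      OF program_computable_rename[OF assms(1)] assms(2)]
  by (simp add: mult.commute)

lemma program_computable_of_bool: "program_decidable P \<Longrightarrow> program_computable (\<lambda>x v. of_bool (P x v))"
  by (simp add: program_decidable_def)

lemma program_decidable_nonzero: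
  assumes "program_computable f"
  shows "program_decidable (\<lambda>x v. f x v \<noteq> 0)"
proof -
  have "of_bool (f x v \<noteq> 0) = 1 - (1 - f x v)" for x v by simp
  moreover have "program_computable (\<lambda>x v. 1 - (1 - f x v))"
    by (intro program_computable_diff program_computable_const assms)
  ultimately show ?thesis unfolding program_decidable_def by (simp only:)
qed

lemma program_decidable_not:
  assumes "program_decidable P"
  shows "program_decidable (\<lambda>x v. \<not> P x v)"
proof -
  have "of_bool (\<not> P x v) = 1 - (of_bool (P x v) :: nat)" for x v by simp
  then show ?thesis
    unfolding program_decidable_def
    by (simp only:) (intro program_computable_diff program_computable_const
        program_computable_of_bool assms)
qed

lemma program_decidable_conj:
  assumes "program_decidable P" "program_decidable Q"
  shows "program_decidable (\<lambda>x v. P x v \<and> Q x v)"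
  using program_computable_mult[OF assms[THEN program_computable_of_bool]]
  by (simp add: program_decidable_def of_bool_conj)

lemma program_decidable_disj:
  assumes "program_decidable P" "program_decidable Q"
  shows "program_decidable (\<lambda>x v. P x v \<or> Q x v)"
  using program_decidable_not[OF program_decidable_conj[OF assms[THEN program_decidable_not]]]
  by simp

lemma program_decidable_imp:
  assumes "program_decidable P" "program_decidable Q"
  shows "program_decidable (\<lambda>x v. P x v \<longrightarrow> Q x v)"
  unfolding imp_conv_disj by (intro program_decidable_disj program_decidable_not assms)

lemma program_decidable_le:
  assumes "program_computable f" "program_computable g"
  shows "program_decidable (\<lambda>x v. f x v \<le> g x v)"
  using program_decidable_not[OF program_decidable_nonzero[OF program_computable_diff[OF assms]]]
  by simp

lemma program_decidable_eq:
  assumes "program_computable f" "program_computable g"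
  shows "program_decidable (\<lambda>x v. f x v = g x v)"
proof -
  have "f x v = g x v \<longleftrightarrow> f x v \<le> g x v \<and> g x v \<le> f x v" for x v by auto
  then show ?thesis
    by (simp only:) (intro program_decidable_conj program_decidable_le assms)
qed

lemma program_decidable_ex_less:
  assumes "program_computable f" "program_decidable (\<lambda>x v. P x (\<lambda>k. v (Suc k)) (v 0))"
  shows "program_decidable (\<lambda>x v. \<exists>i<f x v. P x v i)"
proof -
  have "(\<exists>i<f x v. P x v i) \<longleftrightarrow> (\<Sum>i<f x v. of_bool (P x v i) :: nat) \<noteq> 0" for x v by auto
  then show ?thesis
    by (simp only:) (intro program_decidable_nonzero program_computable_sum
        program_computable_of_bool assms)
qed

lemma program_decidable_ex_le:
  assumes "program_computable f" "program_decidable (\<lambda>x v. P x (\<lambda>k. v (Suc k)) (v 0))"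
  shows "program_decidable (\<lambda>x v. \<exists>i\<le>f x v. P x v i)"
  using program_decidable_ex_less[OF program_computable_Suc[OF assms(1)] assms(2)]
  by (simp add: less_Suc_eq_le)

lemma program_decidable_all_less:
  assumes "program_computable f" "program_decidable (\<lambda>x v. P x (\<lambda>k. v (Suc k)) (v 0))"
  shows "program_decidable (\<lambda>x v. \<forall>i<f x v. P x v i)"
  using program_decidable_not[OF program_decidable_ex_less[OF assms(1),
        of "\<lambda>x v i. \<not> P x v i", OF program_decidable_not[OF assms(2)]]]
  by simp

lemma program_decidable_all_le:
  assumes "program_computable f" "program_decidable (\<lambda>x v. P x (\<lambda>k. v (Suc k)) (v 0))"
  shows "program_decidable (\<lambda>x v. \<forall>i\<le>f x v. P x v i)"
  using program_decidable_all_less[OF program_computable_Suc[OF assms(1)] assms(2)]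
  by (simp add: less_Suc_eq_le)

lemma program_computable_bounded_graph:
  assumes b: "program_computable b" "\<And>x v. f x v \<le> b x v"
    and graph: "program_decidable (\<lambda>x v. v 0 = f x (\<lambda>k. v (Suc k)))"
  shows "program_computable f"
proof -
  have "(\<Sum>i<Suc (b x v). i * of_bool (i = f x v)) = f x v" for x v
    using b(2)[of x v] by (simp add: of_bool_def if_distrib[of "(*) _"] sum.delta cong: if_cong)
  moreover have "program_computable (\<lambda>x v. \<Sum>i<Suc (b x v). i * of_bool (i = f x v))"
    using program_computable_of_bool[OF graph]
    by (intro program_computable_sum program_computable_Suc program_computable_mult
        program_computable_var b(1))
  ultimately show ?thesis by simp
qed

lemma program_computable_if:
  assumes "program_decidable P" "program_computable f" "program_computable g"
  shows "program_computable (\<lambda>x v. if P x v then f x v else g x v)"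
proof -
  have "(if P x v then f x v else g x v) = of_bool (P x v) * f x v + of_bool (\<not> P x v) * g x v"
    for x v
    by simp
  moreover have "program_computable (\<lambda>x v. of_bool (P x v) * f x v + of_bool (\<not> P x v) * g x v)"
    by (intro program_computable_add program_computable_mult program_computable_of_bool
        program_decidable_not assms)
  ultimately show ?thesis by (simp only:)
qed

lemmas program_decidable_intros =
  program_decidable_not program_decidable_conj program_decidable_disj program_decidable_imp
  program_decidable_le program_decidable_eq program_decidable_ex_le program_decidable_all_le
  program_decidable_all_less

lemmas program_computable_intros =
  program_computable_var program_computable_const program_computable_Suc program_computable_add
  program_computable_if

subsection \<open>Decoding\<close>

lemma program_computable_div2:
  assumes "program_computable f"
  shows "program_computable (\<lambda>x v. f x v div 2)"
proof (rule program_computable_bounded_graph[OF assms])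
  have "y = n div 2 \<longleftrightarrow> n = y + y \<or> n = Suc (y + y)" for y n :: nat by presburger
  then show "program_decidable (\<lambda>x v. v 0 = f x (\<lambda>k. v (Suc k)) div 2)"
    by (simp only:) (intro program_decidable_intros program_computable_intros
        program_computable_rename[OF assms])
qed simp

lemma program_decidable_even:
  assumes "program_computable f"
  shows "program_decidable (\<lambda>x v. even (f x v))"
proof -
  have "even n \<longleftrightarrow> n = n div 2 + n div 2" for n :: nat by presburger
  then show ?thesis
    by (simp only:) (intro program_decidable_intros program_computable_intros
        program_computable_div2 assms)
qed

lemma int_decode_eq: "int_decode n = (if even n then int (n div 2) else - int (n div 2) - 1)"
  by (simp add: int_decode_def sum_decode_def)

lemma program_computable_int_decode:
  assumes "program_computable f"
  shows "program_computable (\<lambda>x v. nat (int_decode (f x v)))"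
    and "program_computable (\<lambda>x v. nat (- int_decode (f x v)))"
proof -
  have "nat (int_decode n) = (if even n then n div 2 else 0)"
    "nat (- int_decode n) = (if even n then 0 else Suc (n div 2))" for n
    by (auto simp: int_decode_eq)
  then show "program_computable (\<lambda>x v. nat (int_decode (f x v)))"
    "program_computable (\<lambda>x v. nat (- int_decode (f x v)))"
    by (simp_all only:) (intro program_computable_intros program_decidable_even
        program_computable_div2 assms)+
qed

lemma program_computable_triangle:
  assumes "program_computable f"
  shows "program_computable (\<lambda>x v. triangle (f x v))"
proof -
  have "triangle n = (\<Sum>i<Suc n. i)" for n by (induction n) auto
  then show ?thesis
    by (simp only:) (intro program_computable_sum program_computable_intros assms)
qed

lemma prod_decode_iff: "prod_decode n = (a, b) \<longleftrightarrow> triangle (a + b) + a = n"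
proof -
  have "prod_decode n = (a, b) \<longleftrightarrow> n = prod_encode (a, b)"
    by (metis prod_decode_inverse prod_encode_inverse)
  then show ?thesis by (auto simp: prod_encode_def)
qed

lemma program_computable_prod_decode:
  assumes "program_computable f"
  shows "program_computable (\<lambda>x v. fst (prod_decode (f x v)))"
    and "program_computable (\<lambda>x v. snd (prod_decode (f x v)))"
proof -
  have le: "a \<le> n" "b \<le> n" if "prod_decode n = (a, b)" for a b n
    using that le_prod_encode_1[of a b] le_prod_encode_2[of b a]
    by (auto simp: prod_decode_iff prod_encode_def)
  have fst: "a = fst (prod_decode n) \<longleftrightarrow> (\<exists>b\<le>n. triangle (a + b) + a = n)" for a n
    unfolding prod_decode_iff[symmetric] using le by (cases "prod_decode n") auto
  have snd: "b = snd (prod_decode n) \<longleftrightarrow> (\<exists>a\<le>n. triangle (a + b) + a = n)" for b n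
    unfolding prod_decode_iff[symmetric] using le by (cases "prod_decode n") auto
  show "program_computable (\<lambda>x v. fst (prod_decode (f x v)))"
  proof (rule program_computable_bounded_graph[OF assms])
    show "fst (prod_decode (f x v)) \<le> f x v" for x v using le[OF prod.collapse[symmetric]] by blast
  qed (unfold fst, intro program_decidable_intros program_computable_intros
      program_computable_triangle program_computable_rename[OF assms])
  show "program_computable (\<lambda>x v. snd (prod_decode (f x v)))"
  proof (rule program_computable_bounded_graph[OF assms])
    show "snd (prod_decode (f x v)) \<le> f x v" for x v using le[OF prod.collapse[symmetric]] by blast
  qed (unfold snd, intro program_decidable_intros program_computable_intros
      program_computable_triangle program_computable_rename[OF assms])
qed

section \<open>Lanes\<close>

type_synonym matrix = "nat \<Rightarrow> nat \<Rightarrow> nat \<Rightarrow> nat \<Rightarrow> bool"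

definition refuted :: "matrix \<Rightarrow> nat \<Rightarrow> nat \<Rightarrow> nat \<Rightarrow> nat \<Rightarrow> bool" where
  "refuted R K h c l \<longleftrightarrow> (\<forall>k\<le>K. \<exists>m\<le>h. \<forall>i\<le>c. \<exists>j\<le>l. \<not> R k m i j)"

definition first_refuted :: "matrix \<Rightarrow> nat \<Rightarrow> nat \<Rightarrow> nat \<Rightarrow> nat \<Rightarrow> bool" where
  "first_refuted R K h c l \<longleftrightarrow>
     c \<le> l \<and> refuted R K h c l \<and> (\<forall>l'<l. c \<le> l' \<longrightarrow> \<not> refuted R K h c l')"

definition dip :: "matrix \<Rightarrow> nat \<Rightarrow> nat \<Rightarrow> nat \<Rightarrow> bool" where
  "dip R K h l \<longleftrightarrow> (\<exists>K'\<le>h. K \<le> K' \<and> (\<exists>c\<le>l. first_refuted R K' h c l))"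

text \<open>The dip \<open>(h, l)\<close> contributes the depth \<open>min (l - h) (t - h - l)\<close>: it begins at \<open>t = h + l\<close> and
  is deepest from \<open>t = 2 * l\<close> on.\<close>

definition depth :: "matrix \<Rightarrow> nat \<Rightarrow> nat \<Rightarrow> nat" where
  "depth R K t = Max {s. s = 0 \<or> (\<exists>h l. dip R K h l \<and> s + h \<le> l \<and> s + h + l \<le> t)}"

subsection \<open>Dips\<close>

lemma dip_antimono: "dip R K' h l \<Longrightarrow> K \<le> K' \<Longrightarrow> dip R K h l"
  unfolding dip_def using le_trans by blast

lemma first_refuted_unique:
  "first_refuted R K h c l \<Longrightarrow> first_refuted R K h c l' \<Longrightarrow> l = l'"
  unfolding first_refuted_def by (metis linorder_neqE_nat)

lemma first_refuted_ex:
  assumes "c \<le> l" "refuted R K h c l"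
  obtains l' where "first_refuted R K h c l'"
proof
  let ?P = "\<lambda>l. c \<le> l \<and> refuted R K h c l"
  show "first_refuted R K h c (LEAST l. ?P l)"
    using LeastI[of ?P l] not_less_Least[of _ ?P] assms unfolding first_refuted_def by blast
qed

lemma finite_dips:
  assumes "\<forall>m. \<exists>i. \<forall>j. R K m i j"
  shows "finite {l. dip R K h l}"
proof -
  obtain I where I: "\<And>m j. R K m (I m) j" using assms by metis
  have small: "c < Max (I ` {..h})" if K': "first_refuted R K' h c l" "K \<le> K'" for K' c l
  proof -
    obtain m where m: "m \<le> h" "\<forall>i\<le>c. \<exists>j\<le>l. \<not> R K m i j"
      using K' by (auto simp: first_refuted_def refuted_def)
    then have "\<not> I m \<le> c" using I by blast
    then have "c < I m" by simp
    also have "I m \<le> Max (I ` {..h})" using m(1) by simp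
    finally show ?thesis .
  qed
  have "{l. dip R K h l} \<subseteq>
      (\<Union>K'\<in>{..h}. \<Union>c\<in>{..<Max (I ` {..h})}. {l. first_refuted R K' h c l})"
    using small unfolding dip_def by blast
  moreover have "finite {l. first_refuted R K' h c l}" for K' c
  proof (cases "{l. first_refuted R K' h c l} = {}")
    case False
    then obtain l where "first_refuted R K' h c l" by blast
    then have "{l. first_refuted R K' h c l} \<subseteq> {l}" using first_refuted_unique by blast
    then show ?thesis by (rule finite_subset) simp
  qed simp
  ultimately show ?thesis by (auto intro: finite_subset)
qed

lemma infinite_dips:
  assumes "\<And>k. k \<le> K \<Longrightarrow> \<exists>m. \<forall>i. \<exists>j. \<not> R k m i j"
  obtains h where "infinite {l. dip R K h l}"
proof -
  obtain M where "\<And>k i. k \<le> K \<Longrightarrow> \<exists>j. \<not> R k (M k) i j" using assms by metis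
  then obtain J where J: "\<And>k i. k \<le> K \<Longrightarrow> \<not> R k (M k) i (J k i)" by metis
  define h where "h = max K (Max (M ` {..K}))"
  have M_le: "M k \<le> h" if "k \<le> K" for k
    using that unfolding h_def by (intro max.coboundedI2) simp
  have "\<exists>l\<ge>c. dip R K h l" for c
  proof -
    define L where "L = max c (Max ((\<lambda>(k, i). J k i) ` ({..K} \<times> {..c})))"
    have "J k i \<le> L" if "k \<le> K" "i \<le> c" for k i
      using that unfolding L_def by (intro max.coboundedI2 Max_ge) auto
    then have "refuted R K h c L" unfolding refuted_def using M_le J by blast
    moreover have "c \<le> L" by (simp add: L_def)
    ultimately obtain l where l: "first_refuted R K h c l" using first_refuted_ex by metis
    then have "c \<le> l" by (simp add: first_refuted_def)
    moreover have "K \<le> h" by (simp add: h_def)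
    ultimately show ?thesis using l unfolding dip_def by blast
  qed
  then show thesis using that unfolding infinite_nat_iff_unbounded_le by blast
qed

subsection \<open>The depth of a lane\<close>

lemma le_depth_iff:
  "s \<le> depth R K t \<longleftrightarrow> s = 0 \<or> (\<exists>h l. dip R K h l \<and> s + h \<le> l \<and> s + h + l \<le> t)"
proof -
  let ?S = "{s. s = 0 \<or> (\<exists>h l. dip R K h l \<and> s + h \<le> l \<and> s + h + l \<le> t)}"
  have "?S \<subseteq> {..t}" by auto
  then have fin: "finite ?S" by (rule finite_subset) simp
  have "depth R K t \<in> ?S" unfolding depth_def using fin by (intro Max_in) auto
  moreover have "s \<in> ?S" if "s' \<in> ?S" "s \<le> s'" for s s'
  proof (cases "s' = 0")
    case False
    then obtain h l where "dip R K h l" "s' + h \<le> l" "s' + h + l \<le> t" using \<open>s' \<in> ?S\<close> by blast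
    moreover from this have "s + h \<le> l" "s + h + l \<le> t" using \<open>s \<le> s'\<close> by linarith+
    ultimately show ?thesis by blast
  qed (use that in simp)
  moreover have "s \<le> depth R K t" if "s \<in> ?S" for s
    unfolding depth_def using fin that by (rule Max_ge)
  ultimately show ?thesis by blast
qed

lemma depth_attained:
  "depth R K t = 0 \<or> (\<exists>h l. dip R K h l \<and> depth R K t + h \<le> l \<and> depth R K t + h + l \<le> t)"
  by (rule le_depth_iff[THEN iffD1]) simp

lemma depth_le: "2 * depth R K t \<le> t"
  using depth_attained[of R K t] by auto

lemma depth_antimono: "K \<le> K' \<Longrightarrow> depth R K' t \<le> depth R K t"
  using depth_attained[of R K' t] dip_antimono[of R K' _ _ K] unfolding le_depth_iff by blast

lemma depth_le_depth_Suc: "depth R K t \<le> depth R K (Suc t)"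
  using depth_attained[of R K t] le_SucI unfolding le_depth_iff by blast

lemma depth_Suc_le: "depth R K (Suc t) \<le> Suc (depth R K t)"
proof (cases "depth R K (Suc t)")
  case (Suc s)
  then obtain h l where "dip R K h l" "Suc s + h \<le> l" "Suc s + h + l \<le> Suc t"
    using le_depth_iff[of "Suc s" R K "Suc t"] by auto
  then have "dip R K h l \<and> s + h \<le> l \<and> s + h + l \<le> t" by simp
  then have "s \<le> depth R K t" unfolding le_depth_iff by blast
  then show ?thesis using Suc by simp
qed simp

lemma depth_cong:
  assumes "\<And>k m i j. k \<le> t \<Longrightarrow> m \<le> t \<Longrightarrow> i \<le> t \<Longrightarrow> j \<le> t \<Longrightarrow> R k m i j = R' k m i j"
  shows "depth R K t = depth R' K t"
proof -
  have refuted: "refuted R K' h c l = refuted R' K' h c l"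
    if "K' \<le> t" "h \<le> t" "c \<le> t" "l \<le> t" for K' h c l
    unfolding refuted_def using assms that by (meson le_trans)
  have first_refuted: "first_refuted R K' h c l = first_refuted R' K' h c l"
    if "K' \<le> t" "h \<le> t" "l \<le> t" for K' h c l
    unfolding first_refuted_def using that
    by (intro conj_cong refl all_cong1 imp_cong arg_cong[where f = Not] refuted) auto
  have dip: "dip R K h l = dip R' K h l" if "h \<le> t" "l \<le> t" for h l
    unfolding dip_def using that by (intro ex_cong1 conj_cong refl first_refuted) auto
  have "dip R K h l \<and> s + h \<le> l \<and> s + h + l \<le> t \<longleftrightarrow> dip R' K h l \<and> s + h \<le> l \<and> s + h + l \<le> t"
    for s h l using dip[of h l] by auto
  then show ?thesis by (simp only: depth_def)
qed

subsection \<open>Paths in a lane\<close>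

definition neighbours :: "int \<times> int \<Rightarrow> int \<times> int \<Rightarrow> bool" where
  "neighbours s t \<longleftrightarrow>
     (fst t - fst s, snd t - snd s) \<in> {(1, 0), (0, 1), (-1, 1), (-1, 0), (0, -1), (1, -1)}"

definition height :: "int \<times> int \<Rightarrow> int" where
  "height s = fst s + 2 * snd s"

definition lattice_path :: "(int \<times> int \<Rightarrow> bool) \<Rightarrow> (nat \<Rightarrow> int \<times> int) \<Rightarrow> bool" where
  "lattice_path B t \<longleftrightarrow> (\<forall>i. B (t i) \<and> neighbours (t i) (t (Suc i)))"

definition lattice_win :: "(int \<times> int \<Rightarrow> bool) \<Rightarrow> bool" where
  "lattice_win B \<longleftrightarrow> (\<exists>t s. lattice_path B t \<and> lattice_path B s \<and> t 0 = s 0 \<and>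
     (LIM i sequentially. fst (t i) :> at_top) \<and> (LIM i sequentially. height (t i) :> at_top) \<and>
     (LIM i sequentially. fst (s i) :> at_bot) \<and> (LIM i sequentially. height (s i) :> at_bot))"

definition lane :: "matrix \<Rightarrow> nat \<Rightarrow> int \<Rightarrow> int" where
  "lane R K t = 2 * int K - int (depth R K (nat t))"

definition black :: "matrix \<Rightarrow> int \<times> int \<Rightarrow> bool" where
  "black R = (\<lambda>(t, b). \<exists>K. b = lane R K t)"

lemma lane_Suc: "lane R K (t + 1) = lane R K t \<or> lane R K (t + 1) = lane R K t - 1"
proof (cases "0 \<le> t")
  case True
  then have "nat (t + 1) = Suc (nat t)" by simp
  then show ?thesis
    using depth_le_depth_Suc[of R K "nat t"] depth_Suc_le[of R K "nat t"] unfolding lane_def by auto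
qed (simp add: lane_def)

lemma lane_gap: "K < K' \<Longrightarrow> lane R K t + 2 \<le> lane R K' t"
  using depth_antimono[of K K' R "nat t"] unfolding lane_def by simp

lemma neighbours_commute: "neighbours s t \<longleftrightarrow> neighbours t s"
proof -
  let ?D = "{(1, 0), (0, 1), (-1, 1), (-1, 0), (0, -1), (1, -1)} :: (int \<times> int) set"
  have "(- x, - y) \<in> ?D \<longleftrightarrow> (x, y) \<in> ?D" for x y by auto
  from this[of "fst t - fst s" "snd t - snd s"] show ?thesis
    by (simp only: neighbours_def minus_diff_eq)
qed

lemma neighbours_cases:
  assumes "neighbours (t, a) (t', b)"
  obtains (right) "t' = t + 1" "b = a \<or> b = a - 1" | (vertical) "t' = t" "\<bar>b - a\<bar> = 1"
    | (left) "t = t' + 1" "a = b \<or> a = b - 1"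
  using assms unfolding neighbours_def by auto

lemma lanes_not_neighbours:
  assumes "K < K'"
  shows "\<not> neighbours (t, lane R K t) (t', lane R K' t')"
proof
  assume "neighbours (t, lane R K t) (t', lane R K' t')"
  then show False
  proof (cases rule: neighbours_cases)
    case right
    show ?thesis
      using right(2) lane_gap[OF assms, of R t'] lane_Suc[of R K t] unfolding right(1)
      by (elim disjE) linarith+
  next
    case vertical
    then show ?thesis using lane_gap[OF assms, of R t] by simp
  next
    case left
    show ?thesis
      using left(2) lane_gap[OF assms, of R t] lane_Suc[of R K' t'] unfolding left(1)
      by (elim disjE) linarith+
  qed
qed

lemma lattice_path_in_lane:
  assumes t: "lattice_path (black R) t"
  obtains K where "\<And>i. snd (t i) = lane R K (fst (t i))"
    "\<And>i. \<bar>fst (t (Suc i)) - fst (t i)\<bar> = 1"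
proof -
  have black: "\<exists>K. snd (t i) = lane R K (fst (t i))" for i
    using t by (auto simp: lattice_path_def black_def split: prod.splits)
  then obtain K where K: "snd (t 0) = lane R K (fst (t 0))" by blast
  have on: "snd (t i) = lane R K (fst (t i))" for i
  proof (induction i)
    case (Suc i)
    obtain K' where K': "snd (t (Suc i)) = lane R K' (fst (t (Suc i)))" using black by blast
    have "neighbours (fst (t i), lane R K (fst (t i)))
        (fst (t (Suc i)), lane R K' (fst (t (Suc i))))"
      using t Suc.IH K' unfolding lattice_path_def by (metis prod.collapse)
    then have "K' = K" using lanes_not_neighbours neighbours_commute by (metis linorder_neqE_nat)
    with K' show ?case by simp
  qed (rule K)
  have "neighbours (fst (t i), lane R K (fst (t i)))
      (fst (t (Suc i)), lane R K (fst (t (Suc i))))" for i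
    using t on unfolding lattice_path_def by (metis prod.collapse)
  then have "\<bar>fst (t (Suc i)) - fst (t i)\<bar> = 1" for i
    by (rule neighbours_cases[of "fst (t i)" _ "fst (t (Suc i))"]) auto
  with on show thesis by (rule that)
qed

lemma height_lane_dip:
  assumes "dip R K h l"
  shows "height (2 * int l, lane R K (2 * int l)) \<le> 2 * int h + 4 * int K"
proof -
  have "l - h \<le> depth R K (2 * l)"
  proof (cases "h \<le> l")
    case True
    then have "dip R K h l \<and> l - h + h \<le> l \<and> l - h + h + l \<le> 2 * l" using assms by simp
    then show ?thesis unfolding le_depth_iff by blast
  qed simp
  moreover have "nat (2 * int l) = 2 * l" by simp
  ultimately show ?thesis by (simp add: height_def lane_def)
qed

lemma lane_not_ascending:
  assumes inf: "infinite {l. dip R K h l}"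
    and lane: "\<And>i. snd (t i) = lane R K (fst (t i))"
    and step: "\<And>i. \<bar>fst (t (Suc i)) - fst (t i)\<bar> = 1"
    and right: "LIM i sequentially. fst (t i) :> at_top"
  shows "\<not> (LIM i sequentially. height (t i) :> at_top)"
proof
  assume "LIM i sequentially. height (t i) :> at_top"
  then obtain i0 where i0: "\<And>i. i0 \<le> i \<Longrightarrow> 2 * int h + 4 * int K + 1 \<le> height (t i)"
    unfolding filterlim_at_top eventually_sequentially by blast
  obtain l where l: "dip R K h l" "nat (fst (t i0)) \<le> l"
    using inf unfolding infinite_nat_iff_unbounded_le by blast
  obtain n where n: "i0 \<le> n" "2 * int l \<le> fst (t n)"
    using right unfolding filterlim_at_top eventually_sequentially by (meson nat_le_linear)
  have "\<exists>i. i0 \<le> i \<and> i \<le> n \<and> fst (t i) = 2 * int l"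
    using step l(2) n by (intro nat_intermed_int_val) auto
  then obtain i where "i0 \<le> i" "fst (t i) = 2 * int l" by blast
  then have "t i = (2 * int l, lane R K (2 * int l))" using lane[of i] by (simp add: prod_eq_iff)
  then show False using height_lane_dip[OF l(1)] i0[OF \<open>i0 \<le> i\<close>] by simp
qed

lemma lane_ascending:
  assumes "\<And>h. finite {l. dip R K h l}"
  shows "LIM i sequentially. height (int i, lane R K (int i)) :> at_top"
  unfolding filterlim_at_top eventually_sequentially
proof
  fix n :: int
  have "finite (\<Union>h\<in>{..nat n}. {l. dip R K h l})" using assms by auto
  then obtain L where L: "\<And>h l. h \<le> nat n \<Longrightarrow> dip R K h l \<Longrightarrow> l < L"
    unfolding finite_nat_set_iff_bounded by auto
  have "n \<le> height (int j, lane R K (int j))" if j: "nat n + 2 * L \<le> j" for j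
  proof -
    consider (flat) "depth R K j = 0"
      | (dip) h l where "dip R K h l" "depth R K j + h \<le> l" "depth R K j + h + l \<le> j"
      using depth_attained[of R K j] by auto
    then have "n + 2 * int (depth R K j) \<le> int j"
    proof cases
      case dip
      then show ?thesis using L[of h l] j by (cases "h \<le> nat n") auto
    qed (use j in auto)
    then show ?thesis by (simp add: height_def lane_def)
  qed
  then show "\<exists>N. \<forall>j\<ge>N. n \<le> height (int j, lane R K (int j))" by blast
qed

lemma lane_descending: "LIM i sequentially. height (- int i, lane R K (- int i)) :> at_bot"
proof -
  have "depth R K 0 = 0" using depth_le[of R K 0] by simp
  then have "height (- int i, lane R K (- int i)) \<le> n" if "nat (4 * int K - n) \<le> i" for i n
    using that by (simp add: height_def lane_def)
  then show ?thesis unfolding filterlim_at_bot eventually_sequentially by blast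
qed

lemma lattice_win_black: "lattice_win (black R) \<longleftrightarrow> (\<exists>k. \<forall>m. \<exists>i. \<forall>j. R k m i j)"
proof
  assume "lattice_win (black R)"
  then obtain t where t: "lattice_path (black R) t"
    and lim: "LIM i sequentially. fst (t i) :> at_top" "LIM i sequentially. height (t i) :> at_top"
    unfolding lattice_win_def by blast
  obtain K where "\<And>i. snd (t i) = lane R K (fst (t i))" "\<And>i. \<bar>fst (t (Suc i)) - fst (t i)\<bar> = 1"
    by (rule lattice_path_in_lane[OF t]) (rule that)
  then have "finite {l. dip R K h l}" for h using lane_not_ascending lim by blast
  then show "\<exists>k. \<forall>m. \<exists>i. \<forall>j. R k m i j" using infinite_dips[of K R] by metis
next
  assume "\<exists>k. \<forall>m. \<exists>i. \<forall>j. R k m i j"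
  then obtain K where K: "\<forall>m. \<exists>i. \<forall>j. R K m i j" by blast
  define t where "t i = (int i, lane R K (int i))" for i
  define s where "s i = (- int i, lane R K (- int i))" for i
  have step: "neighbours (u, lane R K u) (u + 1, lane R K (u + 1))" for u
    using lane_Suc[of R K u] unfolding neighbours_def by auto
  have "neighbours (t i) (t (Suc i))" for i
    using step[of "int i"] by (simp add: t_def add.commute)
  then have "lattice_path (black R) t" by (auto simp: lattice_path_def t_def black_def)
  moreover have "neighbours (s i) (s (Suc i))" for i
    using step[of "- int (Suc i)"] by (subst neighbours_commute) (simp add: s_def)
  then have "lattice_path (black R) s" by (auto simp: lattice_path_def s_def black_def)
  moreover have "LIM i sequentially. fst (t i) :> at_top"
    by (simp add: t_def filterlim_int_sequentially)
  moreover have "fst (s i) \<le> n" if "nat (- n) \<le> i" for i n using that by (simp add: s_def)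
  then have "LIM i sequentially. fst (s i) :> at_bot"
    unfolding filterlim_at_bot eventually_sequentially by blast
  ultimately show "lattice_win (black R)"
    using lane_ascending[OF finite_dips[of R, OF K]] lane_descending[of R K]
    unfolding lattice_win_def by (intro exI[of _ t] exI[of _ s]) (simp add: t_def s_def)
qed

section \<open>Deciding the colors\<close>

context
  fixes R :: "(nat \<Rightarrow> bool) \<Rightarrow> matrix"
  assumes R: "\<And>a b c d. program_decidable (\<lambda>x v. R x (v a) (v b) (v c) (v d))"
begin

lemma program_decidable_first_refuted:
  assumes "program_computable K" "program_computable h" "program_computable c"
    and "program_computable l"
  shows "program_decidable (\<lambda>x v. first_refuted (R x) (K x v) (h x v) (c x v) (l x v))"
  unfolding first_refuted_def refuted_def
  by (intro program_decidable_intros program_computable_var R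
      assms[THEN program_computable_rename] assms)

lemma program_decidable_dip:
  assumes "program_computable K" "program_computable h" "program_computable l"
  shows "program_decidable (\<lambda>x v. dip (R x) (K x v) (h x v) (l x v))"
  unfolding dip_def
  by (intro program_decidable_intros program_computable_var program_decidable_first_refuted
      assms[THEN program_computable_rename] assms)

lemma program_computable_depth:
  assumes "program_computable K" "program_computable t"
  shows "program_computable (\<lambda>x v. depth (R x) (K x v) (t x v))"
proof (rule program_computable_bounded_graph[OF assms(2)])
  show "depth (R x) (K x v) (t x v) \<le> t x v" for x v
    using depth_le[of "R x" "K x v" "t x v"] by simp
  have le: "s \<le> depth Q k u \<longleftrightarrow> s = 0 \<or> (\<exists>h\<le>u. \<exists>l\<le>u. dip Q k h l \<and> s + h \<le> l \<and> s + h + l \<le> u)"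
    for s k u and Q :: matrix
  proof -
    have "h \<le> u" "l \<le> u" if "s + h + l \<le> u" for h l using that by simp_all
    then show ?thesis unfolding le_depth_iff by blast
  qed
  have "s = depth Q k u \<longleftrightarrow> s \<le> depth Q k u \<and> \<not> Suc s \<le> depth Q k u" for s k u and Q :: matrix
    by auto
  then show "program_decidable (\<lambda>x v.
      v 0 = depth (R x) (K x (\<lambda>k. v (Suc k))) (t x (\<lambda>k. v (Suc k))))"
    unfolding le
    by (simp only:) (intro program_decidable_intros program_computable_intros program_decidable_dip
        assms[THEN program_computable_rename])
qed

lemma black_iff:
  "black Q (t, b) \<longleftrightarrow>
    (\<exists>K\<le>nat b + nat t. nat b + depth Q K (nat t) = K + K + nat (- b))"
proof -
  have "b = lane Q K t \<longleftrightarrow> nat b + depth Q K (nat t) = K + K + nat (- b)" for K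
    unfolding lane_def by auto
  moreover have "K \<le> nat b + nat t" if "nat b + depth Q K (nat t) = K + K + nat (- b)" for K
    using that depth_le[of Q K "nat t"] by linarith
  ultimately show ?thesis unfolding black_def by auto
qed

lemma program_decidable_black:
  assumes "program_computable n"
  shows "program_decidable (\<lambda>x v.
    black (R x) (map_prod int_decode int_decode (prod_decode (n x v))))"
proof -
  have "map_prod int_decode int_decode p = (int_decode (fst p), int_decode (snd p))" for p
    by (cases p) simp
  then show ?thesis
    by (simp only: black_iff)
       (intro program_decidable_intros program_computable_intros program_computable_depth
         program_computable_int_decode program_computable_prod_decode
         assms[THEN program_computable_rename] assms)
qed

end

lemma computable_functional_black:
  assumes R: "computable_rel 4 R" and g: "computable_fun g"
  shows "computable_functional (\<lambda>x n. black (\<lambda>k m i j. R x [k, m, i, j])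
    (map_prod int_decode int_decode (prod_decode (g n))))"
proof -
  have "program_decidable (\<lambda>x v. R x [v a, v b, v c, v d])" for a b c d
    using program_decidable_computable_rel[of "map (\<lambda>a x v. v a) [a, b, c, d]" R] R
      program_computable_var
    by (auto simp: numeral_eq_Suc)
  then have "program_decidable (\<lambda>x v. black (\<lambda>k m i j. R x [k, m, i, j])
      (map_prod int_decode int_decode (prod_decode (g (v 0)))))"
    by (intro program_decidable_black program_computable_computable_fun[OF g]
        program_computable_var)
  then show ?thesis by (rule computable_functional_program_decidable)
qed

section \<open>Geometry of the tiling\<close>

definition hex_vertex :: "real \<Rightarrow> real \<times> real \<Rightarrow> nat \<Rightarrow> real \<times> real" where
  "hex_vertex r c k = c + (r * cos (real k * pi / 3), r * sin (real k * pi / 3))"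

definition hex_side :: "real \<Rightarrow> real \<times> real \<Rightarrow> nat \<Rightarrow> (real \<times> real) set" where
  "hex_side r c k = closed_segment (hex_vertex r c k) (hex_vertex r c (Suc k mod 6))"

text \<open>An outer normal of the side number \<open>k\<close>, of length \<open>2\<close>.\<close>

definition hex_normal :: "nat \<Rightarrow> real \<times> real" where
  "hex_normal k =
     [(sqrt 3, 1), (0, 2), (- sqrt 3, 1), (- sqrt 3, - 1), (0, - 2), (sqrt 3, - 1)] ! k"

lemma trig_sixths:
  "cos (2 * pi / 3) = - 1 / 2" "sin (2 * pi / 3) = sqrt 3 / 2"
  "cos (4 * pi / 3) = - 1 / 2" "sin (4 * pi / 3) = - sqrt 3 / 2"
  "cos (5 * pi / 3) = 1 / 2" "sin (5 * pi / 3) = - sqrt 3 / 2"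
proof -
  have "2 * pi / 3 = pi - pi / 3" by simp
  then show "cos (2 * pi / 3) = - 1 / 2" "sin (2 * pi / 3) = sqrt 3 / 2"
    by (simp_all only: cos_diff sin_diff cos_60 sin_60 cos_pi sin_pi, simp_all?)
  have "4 * pi / 3 = pi / 3 + pi" by simp
  then show "cos (4 * pi / 3) = - 1 / 2" "sin (4 * pi / 3) = - sqrt 3 / 2"
    by (simp_all only: cos_add sin_add cos_60 sin_60 cos_pi sin_pi, simp_all?)
  have "5 * pi / 3 = 2 * pi - pi / 3" by simp
  then show "cos (5 * pi / 3) = 1 / 2" "sin (5 * pi / 3) = - sqrt 3 / 2"
    by (simp_all only: cos_2pi_minus sin_2pi_minus cos_60 sin_60, simp_all?)
qed

lemma hex_vertex_simps:
  "hex_vertex r c 0 = c + (r, 0)"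
  "hex_vertex r c 1 = c + (r / 2, sqrt 3 / 2 * r)"
  "hex_vertex r c 2 = c + (- r / 2, sqrt 3 / 2 * r)"
  "hex_vertex r c 3 = c + (- r, 0)"
  "hex_vertex r c 4 = c + (- r / 2, - (sqrt 3 / 2 * r))"
  "hex_vertex r c 5 = c + (r / 2, - (sqrt 3 / 2 * r))"
  by (simp_all add: hex_vertex_def trig_sixths cos_60 sin_60)

lemma less_6_cases:
  fixes k :: nat
  assumes "k < 6"
  obtains "k = 0" | "k = 1" | "k = 2" | "k = 3" | "k = 4" | "k = 5"
proof -
  have "k \<in> {0, 1, 2, 3, 4, 5}" using assms by auto
  then show thesis using that by blast
qed

lemma hex_vertex_opposite:
  assumes "k < 6"
  shows "hex_vertex r c ((k + 3) mod 6) = c + c - hex_vertex r c k"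
  using assms by (cases rule: less_6_cases) (simp_all add: hex_vertex_simps del: One_nat_def)

lemma hex_normal_vertex:
  assumes "k < 6" "j < 6"
  shows "hex_normal k \<bullet> hex_vertex r c j =
    hex_normal k \<bullet> c + sqrt 3 * r * (if j = k \<or> j = Suc k mod 6 then 1
      else if j = (k + 3) mod 6 \<or> j = (k + 4) mod 6 then - 1 else 0)"
  using assms(1)
  by (cases rule: less_6_cases; use assms(2) in \<open>cases rule: less_6_cases\<close>)
    (simp_all add: hex_normal_def hex_vertex_simps inner_add_right del: One_nat_def)

lemma hexagon_eq: "hexagon r c = convex hull (hex_vertex r c ` {..<6})"
  by (simp add: hexagon_def hex_vertex_def)

lemma hex_vertex_in_hexagon: "k < 6 \<Longrightarrow> hex_vertex r c k \<in> hexagon r c"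
  unfolding hexagon_eq by (intro hull_inc) auto

lemma hexagon_halfspace:
  assumes "r > 0" "k < 6" "z \<in> hexagon r c"
  shows "hex_normal k \<bullet> z \<le> hex_normal k \<bullet> c + sqrt 3 * r"
proof -
  have "hexagon r c \<subseteq> {z. hex_normal k \<bullet> z \<le> hex_normal k \<bullet> c + sqrt 3 * r}"
    unfolding hexagon_eq using assms(1,2)
    by (intro hull_minimal convex_halfspace_le) (auto simp: hex_normal_vertex)
  then show ?thesis using assms(3) by auto
qed

lemma hexagon_center_inj:
  assumes r: "r > 0" and eq: "hexagon r c = hexagon r c'"
  shows "c = c'"
proof -
  have "hex_normal k \<bullet> c \<le> hex_normal k \<bullet> c'" if "k < 6" "hexagon r c = hexagon r c'" for k c c'
    using hexagon_halfspace[OF r that(1), of "hex_vertex r c k" c'] that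
      hex_vertex_in_hexagon[of k r c]
    by (simp add: hex_normal_vertex)
  then have "hex_normal k \<bullet> c = hex_normal k \<bullet> c'" if "k < 6" for k
    using that eq by (metis order_antisym)
  from this[of 0] this[of 1] show ?thesis
    by (cases c; cases c') (auto simp: hex_normal_def)
qed

lemma hexagon_translate: "(+) w ` hexagon r c = hexagon r (w + c)"
proof -
  have "(+) w ` hex_vertex r c ` {..<6} = hex_vertex r (w + c) ` {..<6}"
    unfolding image_image by (simp add: hex_vertex_def add.assoc)
  then show ?thesis unfolding hexagon_eq by (simp only: convex_hull_translation[symmetric])
qed

subsection \<open>Adjacency\<close>

lemma hex_side_edge_of:
  assumes r: "r > 0" and k: "k < 6"
  shows "hex_side r c k edge_of hexagon r c"
proof -
  let ?n = "hex_normal k" and ?m = "hex_normal k \<bullet> c + sqrt 3 * r"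
  let ?S = "hex_vertex r c ` {..<6}" and ?T = "{hex_vertex r c k, hex_vertex r c (Suc k mod 6)}"
  have on: "?n \<bullet> hex_vertex r c k = ?m" "?n \<bullet> hex_vertex r c (Suc k mod 6) = ?m"
    using k by (simp_all add: hex_normal_vertex)
  have "affine hull ?T \<subseteq> {z. ?n \<bullet> z = ?m}"
    using on by (intro hull_minimal affine_hyperplane) auto
  moreover have "convex hull (?S - ?T) \<subseteq> {z. ?n \<bullet> z < ?m}"
  proof (rule hull_minimal)
    show "?S - ?T \<subseteq> {z. ?n \<bullet> z < ?m}" using r k by (auto simp: hex_normal_vertex)
  qed (rule convex_halfspace_lt)
  ultimately have "affine hull ?T \<inter> convex hull (?S - ?T) = {}" by fastforce
  then have "(convex hull ?T) face_of (convex hull ?S)"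
    using k by (intro face_of_convex_hulls) auto
  moreover have "hex_vertex r c k \<noteq> hex_vertex r c (Suc k mod 6)"
    using k r by (cases rule: less_6_cases) (auto simp: hex_vertex_simps simp del: One_nat_def)
  ultimately show ?thesis
    unfolding edge_of_def hexagon_eq hex_side_def segment_convex_hull
    by (simp add: aff_dim_convex_hull aff_dim_2)
qed

lemma adjacent_across_side:
  assumes r: "r > 0" and k: "k < 6"
    and c': "c' = hex_vertex r c k + hex_vertex r c (Suc k mod 6) - c"
  shows "adjacent (hexagon r c) (hexagon r c')"
proof -
  have opposite: "hex_vertex r c' ((j + 3) mod 6) = c' + c - hex_vertex r c j" if "j < 6" for j
    using hex_vertex_opposite[OF that, of r c] by (simp add: hex_vertex_def algebra_simps)
  have "Suc ((k + 3) mod 6) mod 6 = (Suc k mod 6 + 3) mod 6" by (simp add: mod_simps)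
  then have "hex_side r c' ((k + 3) mod 6) = hex_side r c k"
    using opposite[OF k] opposite[of "Suc k mod 6"] unfolding hex_side_def c'
    by (simp add: closed_segment_commute algebra_simps)
  then have "hex_side r c k edge_of hexagon r c'"
    using hex_side_edge_of[OF r, of "(k + 3) mod 6" c'] by simp
  moreover have "hex_normal k \<bullet> (c' - c) \<noteq> 0"
    using k r by (simp add: c' inner_diff_right inner_add_right hex_normal_vertex)
  then have "c \<noteq> c'" by auto
  then have "hexagon r c \<noteq> hexagon r c'" using hexagon_center_inj[OF r] by blast
  ultimately show ?thesis unfolding adjacent_def using hex_side_edge_of[OF r k] by blast
qed

definition center :: "real \<Rightarrow> real \<times> real \<Rightarrow> int \<times> int \<Rightarrow> real \<times> real" where
  "center r p s = (fst p + 3 / 2 * r * of_int (fst s), snd p + sqrt 3 / 2 * r * of_int (height s))"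

lemma hex_tile_eq: "hex_tile r p s = hexagon r (center r p s)"
  unfolding hex_tile_def center_def height_def
  by (cases s; cases p) (auto simp: algebra_simps intro!: arg_cong[where f = "hexagon r"])

lemma center_inj: "r > 0 \<Longrightarrow> center r p s = center r p t \<Longrightarrow> s = t"
  by (cases s; cases t) (auto simp: center_def height_def)

lemma hex_tile_inj: "r > 0 \<Longrightarrow> hex_tile r p s = hex_tile r p t \<longleftrightarrow> s = t"
  unfolding hex_tile_eq using hexagon_center_inj center_inj by blast

lemma ex_hex_tile_translate:
  assumes "r > 0"
  shows "(\<exists>u. P u \<and> (\<exists>v. Q v \<and> hex_tile r p t = (+) (u, v) ` hex_tile r p s)) \<longleftrightarrow>
    P (3 / 2 * r * of_int (fst t - fst s)) \<and> Q (sqrt 3 / 2 * r * of_int (height t - height s))"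
proof -
  have "hex_tile r p t = (+) w ` hex_tile r p s \<longleftrightarrow> w = center r p t - center r p s" for w
    unfolding hex_tile_eq hexagon_translate eq_diff_eq using hexagon_center_inj[OF assms] by metis
  moreover have "center r p t - center r p s =
      (3 / 2 * r * of_int (fst t - fst s), sqrt 3 / 2 * r * of_int (height t - height s))"
    by (simp add: center_def algebra_simps)
  ultimately show ?thesis by (simp only: prod.inject) blast
qed

lemma meeting_hexagons:
  assumes r: "r > 0" and z: "z \<in> hexagon r c" "z \<in> hexagon r c'" and k: "k < 3"
  shows "\<bar>hex_normal k \<bullet> (c' - c)\<bar> \<le> sqrt 3 * r * 2"
proof -
  have "k \<in> {0, 1, 2}" using k by auto
  then have "hex_normal (k + 3) = - hex_normal k" by (auto simp: hex_normal_def)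
  then show ?thesis
    using hexagon_halfspace[OF r _ z(1), of k] hexagon_halfspace[OF r _ z(1), of "k + 3"]
      hexagon_halfspace[OF r _ z(2), of k] hexagon_halfspace[OF r _ z(2), of "k + 3"] k
    by (simp add: inner_diff_right abs_le_iff)
qed

lemma meeting_tiles:
  assumes r: "r > 0" and z: "z \<in> hex_tile r p s" "z \<in> hex_tile r p t"
  shows "s = t \<or> neighbours s t"
proof -
  define a where "a = fst t - fst s"
  define b where "b = snd t - snd s"
  have bound: "\<bar>m\<bar> \<le> 2"
    if "k < 3" "hex_normal k \<bullet> (center r p t - center r p s) = sqrt 3 * r * of_int m" for k m
  proof -
    have "sqrt 3 * r * \<bar>of_int m\<bar> \<le> sqrt 3 * r * 2"
      using meeting_hexagons[OF r z[unfolded hex_tile_eq] that(1)] r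
      unfolding that(2) by (simp add: abs_mult)
    then have "\<bar>of_int m :: real\<bar> \<le> 2" using r by simp
    then show ?thesis by linarith
  qed
  have "\<bar>2 * a + b\<bar> \<le> 2"
    by (rule bound[of 0])
      (simp_all add: hex_normal_def center_def height_def a_def b_def algebra_simps)
  moreover have "\<bar>a + 2 * b\<bar> \<le> 2"
    by (rule bound[of 1])
      (simp_all add: hex_normal_def center_def height_def a_def b_def algebra_simps)
  moreover have "\<bar>b - a\<bar> \<le> 2"
    by (rule bound[of 2])
      (simp_all add: hex_normal_def center_def height_def a_def b_def algebra_simps)
  ultimately have "a \<in> {-1, 0, 1}" "b \<in> {-1, 0, 1}" "\<bar>2 * a + b\<bar> \<le> 2" "\<bar>a + 2 * b\<bar> \<le> 2" by auto
  then have "(a, b) \<in> {(0, 0), (1, 0), (0, 1), (-1, 1), (-1, 0), (0, -1), (1, -1)}" by auto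
  then show ?thesis by (auto simp: neighbours_def a_def b_def prod_eq_iff)
qed

lemma center_across_side:
  assumes "neighbours s t"
  obtains k where "k < 6"
    "center r p t = hex_vertex r (center r p s) k +
      hex_vertex r (center r p s) (Suc k mod 6) - center r p s"
proof -
  let ?L = "[(1, 0), (0, 1), (-1, 1), (-1, 0), (0, -1), (1, -1)] :: (int \<times> int) list"
  have "(fst t - fst s, snd t - snd s) \<in> set ?L" using assms by (simp add: neighbours_def)
  then obtain k where "k < length ?L" and L: "?L ! k = (fst t - fst s, snd t - snd s)"
    unfolding in_set_conv_nth by blast
  then have k: "k < 6" by simp
  have "t = (fst s + fst (?L ! k), snd s + snd (?L ! k))" unfolding L by simp
  moreover from k have "center r p (fst s + fst (?L ! k), snd s + snd (?L ! k)) =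
      hex_vertex r (center r p s) k +
      hex_vertex r (center r p s) (Suc k mod 6) - center r p s"
    by (cases rule: less_6_cases)
      (simp_all add: center_def height_def hex_vertex_simps field_simps del: One_nat_def)
  ultimately show thesis using that k by simp
qed

lemma adjacent_iff_neighbours:
  assumes r: "r > 0"
  shows "adjacent (hex_tile r p s) (hex_tile r p t) \<longleftrightarrow> neighbours s t"
proof
  assume adj: "adjacent (hex_tile r p s) (hex_tile r p t)"
  then obtain F where F: "F edge_of hex_tile r p s" "F edge_of hex_tile r p t"
    unfolding adjacent_def by blast
  then have "F \<noteq> {}" "F \<subseteq> hex_tile r p s" "F \<subseteq> hex_tile r p t"
    by (auto simp: edge_of_def dest: face_of_imp_subset)
  then show "neighbours s t" using meeting_tiles[OF r] adj unfolding adjacent_def by blast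
next
  assume "neighbours s t"
  then show "adjacent (hex_tile r p s) (hex_tile r p t)"
    unfolding hex_tile_eq by (rule center_across_side) (rule adjacent_across_side[OF r])
qed

subsection \<open>Winning colorings in lattice coordinates\<close>

lemma northeast_neighbour_iff:
  assumes r: "r > 0"
  shows "northeast_neighbour (hex_tile r p s) (hex_tile r p t) \<longleftrightarrow> t = (fst s + 1, snd s)"
proof -
  have "(\<exists>u>0. \<exists>v>0. hex_tile r p t = (+) (u, v) ` hex_tile r p s) \<longleftrightarrow>
      fst s < fst t \<and> height s < height t"
    unfolding ex_hex_tile_translate[OF r] using r by (auto simp: zero_less_mult_iff mult_less_0_iff)
  then show ?thesis
    unfolding northeast_neighbour_def adjacent_iff_neighbours[OF r]
    by (auto simp: neighbours_def height_def prod_eq_iff)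
qed

lemma diagonal_coordinates:
  assumes r: "r > 0" and d: "\<forall>n. d n \<in> hex_tiling r p"
    and ne: "\<forall>n. northeast_neighbour (d (n - 1)) (d n)"
  obtains a b where "\<And>n. d n = hex_tile r p (a + n, b)"
proof -
  obtain a b where ab: "d 0 = hex_tile r p (a, b)"
    using d unfolding hex_tiling_def by (metis prod.collapse rangeE)
  have step: "t = (fst s + 1, snd s)" if "d (n - 1) = hex_tile r p s" "d n = hex_tile r p t"
    for n s t
    using ne that northeast_neighbour_iff[OF r] by metis
  have "d n = hex_tile r p (a + n, b)" for n
  proof (induction n rule: int_induct[where k = 0])
    case base
    show ?case by (simp add: ab)
  next
    case (step1 i)
    obtain t where "d (i + 1) = hex_tile r p t" using d unfolding hex_tiling_def by blast
    with step[of "i + 1" "(a + i, b)" t] step1 show ?case by (simp add: add.assoc)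
  next
    case (step2 i)
    obtain s where "d (i - 1) = hex_tile r p s" using d unfolding hex_tiling_def by blast
    with step[of i s "(a + i, b)"] step2 show ?case by (cases s) (simp add: algebra_simps)
  qed
  then show thesis by (rule that)
qed

lemma filterlim_at_top_add_iff:
  fixes f :: "'a \<Rightarrow> int"
  shows "(\<forall>n. \<forall>\<^sub>F i in F. c + n \<le> f i) \<longleftrightarrow> filterlim f at_top F"
  unfolding filterlim_at_top by (metis add_diff_cancel_left' diff_add_cancel add.commute)

lemma filterlim_at_bot_add_iff:
  fixes f :: "'a \<Rightarrow> int"
  shows "(\<forall>n. \<forall>\<^sub>F i in F. f i \<le> c + n) \<longleftrightarrow> filterlim f at_bot F"
  unfolding filterlim_at_bot by (metis add_diff_cancel_left' diff_add_cancel add.commute)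

context
  fixes r p d a b
  assumes r: "r > 0" and d: "\<And>n. d n = hex_tile r p (a + n, b)"
begin

lemma Q_plus_iff:
  "hex_tile r p s \<in> Q_plus (hex_tiling r p) d n \<longleftrightarrow> a + n \<le> fst s \<and> a + 2 * b + n \<le> height s"
proof -
  have "(\<exists>u\<ge>0. \<exists>v\<ge>0. hex_tile r p s = (+) (u, v) ` d n) \<longleftrightarrow>
      a + n \<le> fst s \<and> height (a + n, b) \<le> height s"
    unfolding d ex_hex_tile_translate[OF r] using r by (auto simp: zero_le_mult_iff mult_le_0_iff)
  then show ?thesis by (auto simp: Q_plus_def hex_tiling_def height_def)
qed

lemma Q_minus_iff:
  "hex_tile r p s \<in> Q_minus (hex_tiling r p) d n \<longleftrightarrow> fst s \<le> a + n \<and> height s \<le> a + 2 * b + n"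
proof -
  have "(\<exists>u\<le>0. \<exists>v\<le>0. hex_tile r p s = (+) (u, v) ` d n) \<longleftrightarrow>
      fst s \<le> a + n \<and> height s \<le> height (a + n, b)"
    unfolding d ex_hex_tile_translate[OF r] using r by (auto simp: zero_le_mult_iff mult_le_0_iff)
  then show ?thesis by (auto simp: Q_minus_def hex_tiling_def height_def)
qed

lemma reaches_plus_iff:
  "reaches (Q_plus (hex_tiling r p) d) (\<lambda>i. hex_tile r p (t i)) \<longleftrightarrow>
    (LIM i sequentially. fst (t i) :> at_top) \<and> (LIM i sequentially. height (t i) :> at_top)"
  unfolding reaches_def Q_plus_iff eventually_sequentially[symmetric] eventually_conj_iff
    all_conj_distrib filterlim_at_top_add_iff ..

lemma reaches_minus_iff:
  "reaches (Q_minus (hex_tiling r p) d) (\<lambda>i. hex_tile r p (t i)) \<longleftrightarrow>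
    (LIM i sequentially. fst (t i) :> at_bot) \<and> (LIM i sequentially. height (t i) :> at_bot)"
  unfolding reaches_def Q_minus_iff eventually_sequentially[symmetric] eventually_conj_iff
    all_conj_distrib filterlim_at_bot_add_iff ..

lemma black_path_iff:
  "black_path (hex_tiling r p) x (\<lambda>i. hex_tile r p (t i)) \<longleftrightarrow> lattice_path (\<lambda>s. x (hex_tile r p s)) t"
  unfolding black_path_def lattice_path_def adjacent_iff_neighbours[OF r]
  by (auto simp: hex_tiling_def)

lemma ex_black_path_iff:
  "(\<exists>t. black_path (hex_tiling r p) x t \<and> P t) \<longleftrightarrow>
    (\<exists>t. lattice_path (\<lambda>s. x (hex_tile r p s)) t \<and> P (\<lambda>i. hex_tile r p (t i)))"
proof
  assume "\<exists>t. black_path (hex_tiling r p) x t \<and> P t"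
  then obtain t where t: "black_path (hex_tiling r p) x t" "P t" by blast
  then have "\<forall>i. \<exists>s. t i = hex_tile r p s" unfolding black_path_def hex_tiling_def by blast
  then obtain t' where "t = (\<lambda>i. hex_tile r p (t' i))" by (metis ext)
  with t show "\<exists>t. lattice_path (\<lambda>s. x (hex_tile r p s)) t \<and> P (\<lambda>i. hex_tile r p (t i))"
    by (auto simp: black_path_iff)
qed (auto simp: black_path_iff[symmetric])

lemma winning_for_black_iff_lattice_win:
  "winning_for_black (hex_tiling r p) d x \<longleftrightarrow> lattice_win (\<lambda>s. x (hex_tile r p s))"
proof -
  have "winning_for_black (hex_tiling r p) d x \<longleftrightarrow>
      (\<exists>t. black_path (hex_tiling r p) x t \<and> (\<exists>s. black_path (hex_tiling r p) x s \<and> t 0 = s 0 \<and>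
        reaches (Q_plus (hex_tiling r p) d) t \<and> reaches (Q_minus (hex_tiling r p) d) s))"
    unfolding winning_for_black_def by blast
  then show ?thesis
    unfolding ex_black_path_iff reaches_plus_iff reaches_minus_iff hex_tile_inj[OF r]
      lattice_win_def
    by blast
qed

end

section \<open>Normal forms of boldface sets\<close>

lemma continuous_on_discrete_iff:
  fixes f :: "'a::topological_space \<Rightarrow> 'b::discrete_topology"
  shows "continuous_on UNIV f \<longleftrightarrow> (\<forall>x. \<forall>\<^sub>F y in nhds x. f y = f x)"
  by (simp add: continuous_on_def tendsto_discrete eventually_nhds_conv_at)

lemma eventually_nhds_agree:
  fixes x :: "nat \<Rightarrow> 'b::discrete_topology"
  shows "\<forall>\<^sub>F y in nhds x. \<forall>i<n. y i = x i"
proof -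
  have "\<forall>\<^sub>F y in nhds x. y i = x i" for i
  proof -
    have "continuous_on UNIV (\<lambda>y :: nat \<Rightarrow> 'b. y i)" by (rule continuous_on_product_coordinates)
    then show ?thesis unfolding continuous_on_discrete_iff by blast
  qed
  then have "\<forall>\<^sub>F y in nhds x. \<forall>i\<in>{..<n}. y i = x i" by (intro eventually_ball_finite) auto
  then show ?thesis by (simp only: Ball_def lessThan_iff)
qed

lemma open_contains_cylinder:
  fixes A :: "(nat \<Rightarrow> bool) set"
  assumes "open A" "x \<in> A"
  shows "\<exists>n. \<forall>y. (\<forall>i<n. y i = x i) \<longrightarrow> y \<in> A"
proof -
  have "openin (product_topology (\<lambda>_. euclidean) UNIV) A" using assms(1) by (simp add: open_fun_def)
  from product_topology_open_contains_basis[OF this assms(2)]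
  obtain X where X: "x \<in> (\<Pi>\<^sub>E i\<in>UNIV. X i)" "finite {i. X i \<noteq> UNIV}" "(\<Pi>\<^sub>E i\<in>UNIV. X i) \<subseteq> A"
    by auto
  obtain n where n: "\<And>i. X i \<noteq> UNIV \<Longrightarrow> i < n"
    using X(2) unfolding finite_nat_set_iff_bounded by auto
  have "y i \<in> X i" if "\<forall>i<n. y i = x i" for y i
    using that n[of i] X(1) by (cases "X i = UNIV") (auto simp: PiE_iff)
  then have "y \<in> A" if "\<forall>i<n. y i = x i" for y using X(3) that by (auto simp: PiE_iff)
  then show ?thesis by blast
qed

lemma not_prefix:
  "\<not> exists_prefix n P \<longleftrightarrow> forall_prefix n (\<lambda>as. \<not> P as)"
  "\<not> forall_prefix n P \<longleftrightarrow> exists_prefix n (\<lambda>as. \<not> P as)"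
  by (induction n arbitrary: P) simp_all

lemma boldface_Sigma_normal_form:
  fixes A :: "(nat \<Rightarrow> bool) set"
  assumes "A \<in> boldface_Sigma (Suc n)"
  shows "\<exists>R. A = {x. exists_prefix (Suc n) (R x)} \<and> (\<forall>as. continuous_on UNIV (\<lambda>x. R x as))"
  using assms
proof (induction n arbitrary: A)
  case 0
  define R where "R x as \<longleftrightarrow> (\<forall>y. (\<forall>i<hd as. y i = x i) \<longrightarrow> y \<in> A)" for x :: "nat \<Rightarrow> bool" and as
  have "A = {x. exists_prefix (Suc 0) (R x)}"
    using open_contains_cylinder[of A] 0 by (auto simp: R_def)
  moreover have "\<forall>\<^sub>F y in nhds x. R y as = R x as" for x as
    by (rule eventually_mono[OF eventually_nhds_agree[of "hd as" x]]) (simp add: R_def)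
  then have "continuous_on UNIV (\<lambda>x. R x as)" for as
    by (simp add: continuous_on_discrete_iff)
  ultimately show ?case by blast
next
  case (Suc n)
  from Suc.prems obtain B :: "nat \<Rightarrow> (nat \<Rightarrow> bool) set"
    where B: "A = (\<Union>i. - B i)" "\<forall>i. B i \<in> boldface_Sigma (Suc n)"
    by (simp only: boldface_Sigma.simps mem_Collect_eq) blast
  have "\<forall>i. \<exists>R. B i = {x. exists_prefix (Suc n) (R x)} \<and> (\<forall>as. continuous_on UNIV (\<lambda>x. R x as))"
    using B(2) Suc.IH by simp
  then obtain R where "\<forall>i. B i = {x. exists_prefix (Suc n) (R i x)} \<and>
      (\<forall>as. continuous_on UNIV (\<lambda>x. R i x as))"
    unfolding choice_iff by blast
  then have R: "\<And>i. B i = {x. exists_prefix (Suc n) (R i x)}"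
    "\<And>i as. continuous_on UNIV (\<lambda>x. R i x as)" by blast+
  let ?R = "\<lambda>x as. \<not> R (hd as) x (tl as)"
  have "A = {x. exists_prefix (Suc (Suc n)) (?R x)}"
    unfolding B(1) R(1) by (simp add: not_prefix set_eq_iff)
  moreover have "continuous_on UNIV (\<lambda>x. ?R x as)" for as
    using R(2) unfolding continuous_on_discrete_iff by (auto elim!: eventually_mono)
  ultimately show ?case by (intro exI[of _ ?R] conjI allI)
qed

lemma exists_prefix_4: "exists_prefix 4 P \<longleftrightarrow> (\<exists>k. \<forall>m. \<exists>i. \<forall>j. P [k, m, i, j])"
  by (simp add: numeral_eq_Suc)

section \<open>Hardness\<close>

lemma continuous_on_black:
  fixes R :: "'a::topological_space \<Rightarrow> matrix"
  assumes R: "\<And>k m i j. continuous_on UNIV (\<lambda>x. R x k m i j)"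
  shows "continuous_on UNIV (\<lambda>x n. black (R x) (c n))"
proof (rule continuous_on_coordinatewise_then_product)
  fix n
  obtain t b where c: "c n = (t, b)" by (cases "c n")
  have "\<forall>\<^sub>F y in nhds x. black (R y) (t, b) = black (R x) (t, b)" for x
  proof -
    let ?I = "{..nat t}"
    have "\<forall>\<^sub>F y in nhds x. \<forall>k\<in>?I. \<forall>m\<in>?I. \<forall>i\<in>?I. \<forall>j\<in>?I. R y k m i j = R x k m i j"
      using R unfolding continuous_on_discrete_iff by (intro eventually_ball_finite ballI) auto
    then show ?thesis
    proof (rule eventually_mono)
      fix y assume "\<forall>k\<in>?I. \<forall>m\<in>?I. \<forall>i\<in>?I. \<forall>j\<in>?I. R y k m i j = R x k m i j"
      then have "depth (R y) K (nat t) = depth (R x) K (nat t)" for K by (intro depth_cong) auto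
      then show "black (R y) (t, b) = black (R x) (t, b)" by (simp add: black_def lane_def)
    qed
  qed
  then show "continuous_on UNIV (\<lambda>x. black (R x) (c n))" by (simp add: c continuous_on_discrete_iff)
qed

lemma vimage_winning_set:
  assumes r: "r > 0" and d: "\<forall>n. d n \<in> hex_tiling r p"
    and ne: "\<forall>n. northeast_neighbour (d (n - 1)) (d n)"
    and e: "bij_betw e UNIV (hex_tiling r p)" "\<And>n. e n = hex_tile r p (c n)"
  shows "(\<lambda>x n. black (R x) (c n)) -` winning_set (hex_tiling r p) d e =
    {x. \<exists>k. \<forall>m. \<exists>i. \<forall>j. R x k m i j}"
proof -
  obtain a b where "\<And>n. d n = hex_tile r p (a + n, b)"
    by (rule diagonal_coordinates[OF r d ne]) (rule that)
  note winning = winning_for_black_iff_lattice_win[OF r this]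
  have "coloring_of e (\<lambda>n. black (R x) (c n)) (hex_tile r p s) = black (R x) s" for x s
  proof -
    have "hex_tile r p s \<in> range e" using e(1) by (auto simp: bij_betw_def hex_tiling_def)
    then obtain n where n: "hex_tile r p s = e n" by blast
    then have "c n = s" using e(2)[of n] hex_tile_inj[OF r] by metis
    moreover have "the_inv e (e n) = n" using e(1) by (simp add: bij_betw_def the_inv_f_f)
    ultimately show ?thesis unfolding coloring_of_def n by simp
  qed
  then show ?thesis by (auto simp: winning_set_def winning lattice_win_black[symmetric])
qed

theorem theorem2:
  fixes r :: real and p :: "real \<times> real"
    and d :: "int \<Rightarrow> tile" and e :: "nat \<Rightarrow> tile"
  assumes "r > 0"
    and "\<forall>n. d n \<in> hex_tiling r p"
    and "\<forall>n. northeast_neighbour (d (n - 1)) (d n)"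
    and "computable_enumeration r p e"
  shows "(\<forall>A \<in> boldface_Sigma 4. \<exists>f :: (nat \<Rightarrow> bool) \<Rightarrow> (nat \<Rightarrow> bool).
            continuous_on UNIV f \<and> f -` winning_set (hex_tiling r p) d e = A) \<and>
         (\<forall>A \<in> lightface_Sigma 4. \<exists>f :: (nat \<Rightarrow> bool) \<Rightarrow> (nat \<Rightarrow> bool).
            computable_functional f \<and> f -` winning_set (hex_tiling r p) d e = A)"
proof -
  obtain g where bij: "bij_betw e UNIV (hex_tiling r p)" and g: "computable_fun g"
    and e: "\<And>n. e n = hex_tile r p (map_prod int_decode int_decode (prod_decode (g n)))"
    using assms(4) unfolding computable_enumeration_def by blast
  define f where "f R x n =
    black (\<lambda>k m i j. R x [k, m, i, j]) (map_prod int_decode int_decode (prod_decode (g n)))"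
    for R :: "(nat \<Rightarrow> bool) \<Rightarrow> nat list \<Rightarrow> bool" and x n
  have win: "f R -` winning_set (hex_tiling r p) d e = {x. exists_prefix 4 (R x)}" for R
    unfolding f_def[abs_def] exists_prefix_4 by (rule vimage_winning_set[OF assms(1-3) bij e])
  show ?thesis
  proof (intro conjI ballI)
    fix A :: "(nat \<Rightarrow> bool) set" assume "A \<in> boldface_Sigma 4"
    then obtain R where A: "A = {x. exists_prefix 4 (R x)}"
      and R: "\<forall>as. continuous_on UNIV (\<lambda>x. R x as)"
      using boldface_Sigma_normal_form[of A 3] by (auto simp: eval_nat_numeral)
    have "continuous_on UNIV (f R)"
      unfolding f_def[abs_def] using R by (intro continuous_on_black) blast
    then show "\<exists>f. continuous_on UNIV f \<and> f -` winning_set (hex_tiling r p) d e = A"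
      using win A by blast
  next
    fix A assume "A \<in> lightface_Sigma 4"
    then obtain R where A: "A = {x. exists_prefix 4 (R x)}" and R: "computable_rel 4 R"
      unfolding lightface_Sigma_def by blast
    have "computable_functional (f R)"
      unfolding f_def[abs_def] using R g by (rule computable_functional_black)
    then show "\<exists>f. computable_functional f \<and> f -` winning_set (hex_tiling r p) d e = A"
      using win A by blast
  qed
qed

end
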